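(* The spectral abscissa map $\mathcal L\ni M\mapsto S_M\in\mathbb R\cup\{-\infty\}$ is continuous on $\mathcal L$ with respect to the total variation norm.
   Context: Fix an integer $d\ge 1$ and a norm $|\cdot|$ on $\mathbb R^d$; $\|\cdot\|$ is the induced matrix norm on the space $\mathcal M_d(\mathbb R)$ of real $d\times d$ matrices and $\mathrm{Id}$ is the identity matrix. For $M:[-1,0]\to\mathcal M_d(\mathbb R)$, the total variation $\operatorname{Var}(M)$ is the supremum of $\sum_{i=1}^k\|M(t_{i+1})-M(t_i)\|$ over all $k\in\mathbb N$ and $-1=t_1<\dots<t_{k+1}=0$. $\mathrm{NBV}([-1,0],\mathcal M_d(\mathbb R))$ is the set of functions $M:[-1,0]\to\mathcal M_d(\mathbb R)$ with $\operatorname{Var}(M)<+\infty$, $M(-1)=0$ and $M$ right-continuous on $(-1,0)$; $\operatorname{Var}$ is a norm on this space (the total variation norm). Such $M$ correspond one-to-one to matrix-valued Borel measures $\mu_M$ on $[-1,0]$ (each entry a finite signed measure) via $M(t)=\mu_M([-1,t])$ for $t\in(-1,0]$. Integrals $\int_{-1}^0\cdots dM(\theta)$ are integrals over $[-1,0]$ with respect to $\mu_M$. Characteristic function: $\Delta_M(s)=\det\left(\mathrm{Id}-\int_{-1}^0 e^{s\theta}dM(\theta)\right)$, $s\in\mathbb C$. Spectral abscissa: $S_M=\sup\{\operatorname{Re}s:\Delta_M(s)=0\}$ ($=-\infty$ if there are no zeros). $\mathcal L$ is the set of $M\in\mathrm{NBV}([-1,0],\mathcal M_d(\mathbb R))$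 such that $S_M<+\infty$ and $\inf_{\operatorname{Re}s\ge\alpha}|\Delta_M(s)|>0$ for every real $\alpha>S_M$. The set $\mathbb R\cup\{-\infty\}$ carries its usual (order) topology. *)

theory Defs
  imports "HOL-Analysis.Analysis"
begin

section \<open>Norms and induced matrix norms\<close>

text \<open>An arbitrary norm on \<open>real ^ 'n\<close>, not necessarily the Euclidean one fixed by the type class.\<close>

definition is_norm :: "(real ^ 'n \<Rightarrow> real) \<Rightarrow> bool" where
  "is_norm N \<longleftrightarrow>
     (\<forall>x. 0 \<le> N x) \<and>
     (\<forall>x. N x = 0 \<longleftrightarrow> x = 0) \<and>
     (\<forall>c x. N (c *\<^sub>R x) = \<bar>c\<bar> * N x) \<and>
     (\<forall>x y. N (x + y) \<le> N x + N y)"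

definition matrix_norm :: "(real ^ 'n \<Rightarrow> real) \<Rightarrow> real ^ 'n ^ 'n \<Rightarrow> real" where
  "matrix_norm N A = (SUP x\<in>{x. x \<noteq> 0}. N (A *v x) / N x)"

section \<open>Functions of normalized bounded variation\<close>

text \<open>In a partition \<open>(t, k)\<close> only the values \<open>t 1, \<dots>, t (k + 1)\<close> matter; \<open>k = 0\<close> is
  excluded by \<open>t 1 = -1\<close> and \<open>t (k + 1) = 0\<close>.\<close>

definition partitions :: "((nat \<Rightarrow> real) \<times> nat) set" where
  "partitions = {(t, k). t 1 = -1 \<and> t (k + 1) = 0 \<and> (\<forall>i\<in>{1..k}. t i < t (i + 1))}"

definition total_variation :: "(real ^ 'n \<Rightarrow> real) \<Rightarrow> (real \<Rightarrow> real ^ 'n ^ 'n) \<Rightarrow> ennreal" where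
  "total_variation N M =
     (SUP (t, k)\<in>partitions. ennreal (\<Sum>i=1..k. matrix_norm N (M (t (i + 1)) - M (t i))))"

text \<open>A function on \<open>[-1, 0]\<close> is represented by its extension by zero to the real line, so that
  equality of representatives is equality of functions on \<open>[-1, 0]\<close>.\<close>

definition NBV :: "(real ^ 'n \<Rightarrow> real) \<Rightarrow> (real \<Rightarrow> real ^ 'n ^ 'n) set" where
  "NBV N = {M. (\<forall>t. t \<notin> {-1..0} \<longrightarrow> M t = 0) \<and>
               total_variation N M < \<infinity> \<and>
               M (-1) = 0 \<and>
               (\<forall>t\<in>{-1<..<0}. continuous (at_right t) M)}"

definition var_dist ::
  "(real ^ 'n \<Rightarrow> real) \<Rightarrow> (real \<Rightarrow> real ^ 'n ^ 'n) \<Rightarrow> (real \<Rightarrow> real ^ 'n ^ 'n) \<Rightarrow> real" where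
  "var_dist N M M' = enn2real (total_variation N (\<lambda>t. M t - M' t))"

section \<open>The matrix-valued measure of \<open>M\<close> and integration against it\<close>

abbreviation borel_I :: "real measure" where
  "borel_I \<equiv> restrict_space borel {-1..0}"

text \<open>A matrix-valued Borel measure on \<open>[-1, 0]\<close>, as a countably additive set function (the series
  over a sequence of empty sets forces \<open>\<mu> {} = 0\<close>). It is set to zero off the Borel subsets
  of \<open>[-1, 0]\<close>, so that it is determined by its values on these.\<close>

definition matrix_measure :: "(real set \<Rightarrow> real ^ 'n ^ 'n) \<Rightarrow> bool" where
  "matrix_measure \<mu> \<longleftrightarrow>
     (\<forall>A. range A \<subseteq> sets borel_I \<and> disjoint_family A \<longrightarrow>
        (\<lambda>i::nat. \<mu> (A i)) sums \<mu> (\<Union>i. A i)) \<and>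
     (\<forall>E. E \<notin> sets borel_I \<longrightarrow> \<mu> E = 0)"

definition measure_of_NBV :: "(real \<Rightarrow> real ^ 'n ^ 'n) \<Rightarrow> real set \<Rightarrow> real ^ 'n ^ 'n" where
  "measure_of_NBV M = (THE \<mu>. matrix_measure \<mu> \<and> (\<forall>t\<in>{-1<..0}. \<mu> {-1..t} = M t))"

text \<open>Integration against a finite signed measure \<open>\<nu>\<close> through its Jordan decomposition
  \<open>\<nu> = \<nu>\<^sup>+ - \<nu>\<^sup>-\<close>, where \<open>\<nu>\<^sup>+ E = sup {\<nu> F | F \<subseteq> E}\<close> and \<open>\<nu>\<^sup>- = (-\<nu>)\<^sup>+\<close>. Negative values
  \<open>\<nu> F\<close> are truncated to \<open>0 = \<nu> {}\<close> by \<open>ennreal\<close>, which does not affect the supremum.\<close>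

definition positive_part :: "(real set \<Rightarrow> real) \<Rightarrow> real measure" where
  "positive_part \<nu> = measure_of {-1..0} (sets borel_I)
     (\<lambda>E. SUP F\<in>{F \<in> sets borel_I. F \<subseteq> E}. ennreal (\<nu> F))"

definition signed_integral :: "(real set \<Rightarrow> real) \<Rightarrow> (real \<Rightarrow> complex) \<Rightarrow> complex" where
  "signed_integral \<nu> f =
     integral\<^sup>L (positive_part \<nu>) f - integral\<^sup>L (positive_part (\<lambda>E. - \<nu> E)) f"

definition matrix_integral ::
  "(real \<Rightarrow> complex) \<Rightarrow> (real \<Rightarrow> real ^ 'n ^ 'n) \<Rightarrow> complex ^ 'n ^ 'n" where
  "matrix_integral f M = (\<chi> i j. signed_integral (\<lambda>E. measure_of_NBV M E $ i $ j) f)"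

section \<open>Characteristic function and spectral abscissa\<close>

definition char_fun :: "(real \<Rightarrow> real ^ 'n ^ 'n) \<Rightarrow> complex \<Rightarrow> complex" where
  "char_fun M s = det (mat 1 - matrix_integral (\<lambda>\<theta>. exp (s * of_real \<theta>)) M)"

text \<open>In \<open>ereal\<close>, \<open>Sup {} = -\<infinity>\<close>.\<close>

definition spectral_abscissa :: "(real \<Rightarrow> real ^ 'n ^ 'n) \<Rightarrow> ereal" where
  "spectral_abscissa M = Sup {ereal (Re s) | s. char_fun M s = 0}"

definition stable_class :: "(real ^ 'n \<Rightarrow> real) \<Rightarrow> (real \<Rightarrow> real ^ 'n ^ 'n) set" where
  "stable_class N = {M \<in> NBV N. spectral_abscissa M < \<infinity> \<and>
     (\<forall>\<alpha>::real. spectral_abscissa M < ereal \<alpha> \<longrightarrow>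
        0 < (INF s\<in>{s. \<alpha> \<le> Re s}. cmod (char_fun M s)))}"

section \<open>The total variation distance is a metric\<close>

lemma matrix_norm_bdd:
  fixes A :: "real ^ 'n ^ 'n"
  assumes N: "is_norm N"
  shows "bdd_above ((\<lambda>x. N (A *v x) / N x) ` {x. x \<noteq> 0})"
proof -
  have nn: "0 \<le> N x" and z: "N x = 0 \<longleftrightarrow> x = 0" and sc: "N (c *\<^sub>R x) = \<bar>c\<bar> * N x"
    and tri: "N (x + y) \<le> N x + N y" for x y c
    using N by (auto simp: is_norm_def)
  have N0: "N 0 = 0" using z by blast
  have Nsum: "N (sum f F) \<le> (\<Sum>i\<in>F. N (f i))" if "finite F" for f :: "'n \<Rightarrow> real ^ 'n" and F
    using that
  proof (induction F)
    case (insert a F)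
    then show ?case using tri[of "f a" "sum f F"] by simp
  qed (simp add: N0)
  define C where "C = (\<Sum>i\<in>UNIV. N (axis i 1))"
  have C: "N x \<le> C * norm x" for x
  proof -
    have "x = (\<Sum>i\<in>UNIV. x $ i *\<^sub>R axis i 1)"
      by (metis (no_types) basis_expansion scalar_mult_eq_scaleR sum.cong)
    then have "N x \<le> (\<Sum>i\<in>UNIV. N (x $ i *\<^sub>R axis i 1))"
      using Nsum[of UNIV "\<lambda>i. x $ i *\<^sub>R axis i 1"] by simp
    also have "\<dots> \<le> (\<Sum>i\<in>UNIV. norm x * N (axis i 1))"
      by (intro sum_mono) (simp add: sc mult_right_mono nn component_le_norm_cart)
    finally show ?thesis by (simp add: C_def sum_distrib_left mult.commute)
  qed
  have "C \<ge> 0" unfolding C_def by (intro sum_nonneg) (simp add: nn)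
  have Ndiff: "\<bar>N x - N y\<bar> \<le> C * norm (x - y)" for x y
    using tri[of "x - y" y] tri[of "y - x" x] C[of "x - y"] C[of "y - x"]
    by (simp add: norm_minus_commute)
  have "C-lipschitz_on (sphere 0 1) N"
    using Ndiff \<open>C \<ge> 0\<close> by (intro lipschitz_onI) (auto simp: dist_norm)
  then have cont: "continuous_on (sphere 0 1) N" by (rule lipschitz_on_continuous_on)
  obtain x0 where x0: "x0 \<in> sphere 0 1" "\<And>x. x \<in> sphere 0 1 \<Longrightarrow> N x0 \<le> N x"
    using continuous_attains_inf[OF compact_sphere _ cont] by (auto simp: ex_in_conv[symmetric] vector_choose_size)
  have c: "N x0 > 0" using x0(1) nn[of x0] z[of x0] by fastforce
  have low: "N x0 * norm x \<le> N x" for x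
  proof (cases "x = 0")
    case False
    have "N x0 \<le> N (inverse (norm x) *\<^sub>R x)" using False by (intro x0(2)) auto
    then show ?thesis using False by (simp add: sc field_simps)
  qed (simp add: N0)
  obtain B where B: "\<And>x. norm (A *v x) \<le> B * norm x" "B > 0"
    using bounded_linear.pos_bounded[OF matrix_vector_mul_bounded_linear[of A]]
    by (metis mult.commute)
  show ?thesis
  proof (rule bdd_aboveI2)
    fix x :: "real ^ 'n" assume "x \<in> {x. x \<noteq> 0}"
    then have xp: "norm x > 0" by simp
    have "N (A *v x) \<le> C * (B * norm x)"
      using C[of "A *v x"] B(1)[of x] \<open>C \<ge> 0\<close> by (meson mult_left_mono order_trans)
    also have "\<dots> = (C * B / N x0) * (N x0 * norm x)" using c by simp
    also have "\<dots> \<le> (C * B / N x0) * N x"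
      using low[of x] c B(2) \<open>C \<ge> 0\<close> by (intro mult_left_mono) auto
    finally show "N (A *v x) / N x \<le> C * B / N x0"
      using low[of x] c xp by (metis mult_pos_pos order_less_le_trans pos_divide_le_eq)
  qed
qed

lemma matrix_norm_upper:
  assumes "is_norm N" "x \<noteq> 0"
  shows "N (A *v x) / N x \<le> matrix_norm N A"
  unfolding matrix_norm_def using assms
  by (intro cSUP_upper matrix_norm_bdd) auto

lemma ex_nonzero_vec: "\<exists>x::real ^ 'n. x \<noteq> 0"
  by (rule exI[of _ "axis undefined 1"]) (simp add: axis_eq_0_iff)

lemma matrix_norm_nonneg:
  assumes "is_norm N"
  shows "0 \<le> matrix_norm N A"
proof -
  obtain x :: "real ^ 'a" where "x \<noteq> 0" using ex_nonzero_vec by blast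
  then show ?thesis using matrix_norm_upper[OF assms, of x A] assms
    by (smt (verit) divide_nonneg_nonneg is_norm_def)
qed

lemma matrix_norm_eq_0:
  assumes N: "is_norm N" and "matrix_norm N A = 0"
  shows "A = 0"
proof -
  have "A *v x = 0 *v x" for x
  proof (cases "x = 0")
    case False
    have "N x > 0" using N False by (smt (verit) is_norm_def)
    moreover have "N (A *v x) / N x \<le> 0" using matrix_norm_upper[OF N False, of A] assms(2) by simp
    ultimately have "N (A *v x) \<le> 0" by (simp add: divide_le_0_iff)
    then show ?thesis using N by (simp add: is_norm_def) (metis order_antisym)
  qed simp
  then show ?thesis using matrix_eq by blast
qed

lemma matrix_norm_0:
  fixes N :: "real ^ 'a \<Rightarrow> real"
  shows "is_norm N \<Longrightarrow> matrix_norm N 0 = 0"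
proof -
  assume "is_norm N"
  then have "N 0 = 0" by (simp add: is_norm_def)
  moreover have "{x :: real ^ 'a. x \<noteq> 0} \<noteq> {}" using ex_nonzero_vec by blast
  ultimately show ?thesis by (simp add: matrix_norm_def cSUP_const del: Collect_empty_eq)
qed

lemma matrix_norm_triangle:
  assumes N: "is_norm N"
  shows "matrix_norm N (A + B) \<le> matrix_norm N A + matrix_norm N B"
  unfolding matrix_norm_def[of N "A + B"]
proof (rule cSUP_least)
  show "{x :: real ^ 'a. x \<noteq> 0} \<noteq> {}" using ex_nonzero_vec by blast
next
  fix x :: "real ^ 'a" assume "x \<in> {x. x \<noteq> 0}"
  then have x: "x \<noteq> 0" by simp
  have "N ((A + B) *v x) / N x \<le> (N (A *v x) + N (B *v x)) / N x"
    using N by (intro divide_right_mono) (auto simp: is_norm_def matrix_vector_mult_add_rdistrib)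
  also have "\<dots> \<le> matrix_norm N A + matrix_norm N B"
    using matrix_norm_upper[OF N x, of A] matrix_norm_upper[OF N x, of B] by (simp add: add_divide_distrib)
  finally show "N ((A + B) *v x) / N x \<le> matrix_norm N A + matrix_norm N B" .
qed

lemma matrix_norm_minus:
  assumes N: "is_norm N"
  shows "matrix_norm N (- A) = matrix_norm N A"
proof -
  have "N (- x) = N x" for x
    using N unfolding is_norm_def by (metis abs_minus_cancel abs_one mult_1 scaleR_minus1_left)
  moreover have "(- A) *v x = - (A *v x)" for x
    using matrix_vector_mult_diff_rdistrib[of 0 A x] by simp
  ultimately show ?thesis by (simp add: matrix_norm_def)
qed

lemma total_variation_triangle:
  assumes N: "is_norm N"
  shows "total_variation N (\<lambda>t. f t + g t) \<le> total_variation N f + total_variation N g"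
  unfolding total_variation_def[of N "\<lambda>t. f t + g t"]
proof (rule SUP_least, clarify)
  fix t k assume p: "(t, k) \<in> partitions"
  let ?s = "\<lambda>h. \<Sum>i=1..k. matrix_norm N (h (t (i + 1)) - h (t i))"
  have up: "ennreal (?s h) \<le> total_variation N h" for h
    unfolding total_variation_def using p by (rule SUP_upper2) auto
  have "?s (\<lambda>t. f t + g t) \<le> ?s f + ?s g"
    unfolding sum.distrib[symmetric]
    by (intro sum_mono) (metis (no_types) matrix_norm_triangle[OF N] add_diff_add)
  then have "ennreal (?s (\<lambda>t. f t + g t)) \<le> ennreal (?s f) + ennreal (?s g)"
    by (metis (no_types, lifting) ennreal_leI ennreal_plus sum_nonneg matrix_norm_nonneg[OF N])
  also have "\<dots> \<le> total_variation N f + total_variation N g"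
    using up by (intro add_mono)
  finally show "ennreal (?s (\<lambda>t. f t + g t)) \<le> total_variation N f + total_variation N g" .
qed

lemma total_variation_minus:
  assumes N: "is_norm N"
  shows "total_variation N (\<lambda>t. - f t) = total_variation N f"
proof -
  have "matrix_norm N (- f a - - f b) = matrix_norm N (f a - f b)" for a b
    using matrix_norm_minus[OF N, of "f a - f b"] by simp
  then show ?thesis by (simp add: total_variation_def)
qed

lemma total_variation_eq_0:
  assumes N: "is_norm N" and "total_variation N f = 0" and "f (-1) = 0" and t: "t \<in> {-1..0}"
  shows "f t = 0"
proof -
  consider "t = -1" | "t = 0" | "-1 < t" "t < 0" using t by fastforce
  then show ?thesis
  proof cases
    case 2
    have "((\<lambda>i. if i = 1 then -1 else 0), 1) \<in> partitions" by (auto simp: partitions_def)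
    then have "ennreal (matrix_norm N (f 0 - f (-1))) \<le> total_variation N f"
      unfolding total_variation_def by (rule SUP_upper2) auto
    then show ?thesis
      using assms 2 matrix_norm_nonneg[OF N] matrix_norm_eq_0[OF N]
      by (metis diff_zero ennreal_eq_0_iff le_zero_eq order_antisym)
  next
    case 3
    have "((\<lambda>i. if i = 1 then -1 else if i = 2 then t else 0), 2) \<in> partitions"
      using 3 by (auto simp: partitions_def)
    then have "ennreal (matrix_norm N (f t - f (-1)) + matrix_norm N (f 0 - f t)) \<le> total_variation N f"
      unfolding total_variation_def by (rule SUP_upper2) (auto simp: eval_nat_numeral)
    then have "matrix_norm N (f t) + matrix_norm N (f 0 - f t) \<le> 0"
      using assms by (simp add: ennreal_eq_0_iff)
    then show ?thesis
      using matrix_norm_nonneg[OF N, of "f t"] matrix_norm_nonneg[OF N, of "f 0 - f t"]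
      by (intro matrix_norm_eq_0[OF N]) linarith
  qed (use assms in simp)
qed

lemma Metric_space_NBV:
  assumes N: "is_norm N"
  shows "Metric_space (NBV N) (var_dist N)"
proof
  fix x y
  show "0 \<le> var_dist N x y" by (simp add: var_dist_def)
  show "var_dist N x y = var_dist N y x"
    using total_variation_minus[OF N, of "\<lambda>t. x t - y t"] by (simp add: var_dist_def)
next
  have fin: "total_variation N (\<lambda>t. x t - y t) < \<infinity>" if "x \<in> NBV N" "y \<in> NBV N" for x y
  proof -
    have "total_variation N (\<lambda>t. x t - y t) \<le> total_variation N x + total_variation N y"
      using total_variation_triangle[OF N, of x "\<lambda>t. - y t"] total_variation_minus[OF N, of y] by simp
    also have "\<dots> < \<infinity>" using that by (simp add: NBV_def)
    finally show ?thesis .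
  qed
  fix x y assume xy: "x \<in> NBV N" "y \<in> NBV N"
  show "var_dist N x y = 0 \<longleftrightarrow> x = y"
  proof
    assume "var_dist N x y = 0"
    then have tv: "total_variation N (\<lambda>t. x t - y t) = 0"
      using fin[OF xy] by (auto simp: var_dist_def enn2real_eq_0_iff)
    show "x = y"
    proof
      fix t show "x t = y t"
      proof (cases "t \<in> {-1..0}")
        case True
        then show ?thesis using total_variation_eq_0[OF N tv _ True] xy by (simp add: NBV_def)
      next
        case False
        then show ?thesis using xy by (simp add: NBV_def)
      qed
    qed
  next
    assume "x = y"
    then show "var_dist N x y = 0"
      using N by (auto simp: var_dist_def total_variation_def matrix_norm_0 enn2real_eq_0_iff
          intro!: disjI1 antisym SUP_least)
  qed
  fix z assume z: "z \<in> NBV N"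
  have "total_variation N (\<lambda>t. x t - z t)
      \<le> total_variation N (\<lambda>t. x t - y t) + total_variation N (\<lambda>t. y t - z t)"
    using total_variation_triangle[OF N, of "\<lambda>t. x t - y t" "\<lambda>t. y t - z t"] by simp
  then have "enn2real (total_variation N (\<lambda>t. x t - z t))
      \<le> enn2real (total_variation N (\<lambda>t. x t - y t) + total_variation N (\<lambda>t. y t - z t))"
    using fin[OF xy] fin[OF xy(2) z] by (intro enn2real_mono) auto
  then show "var_dist N x z \<le> var_dist N x y + var_dist N y z"
    using fin[OF xy] fin[OF xy(2) z] by (simp add: var_dist_def enn2real_plus)
qed

corollary Metric_space_stable_class:
  "is_norm N \<Longrightarrow> Metric_space (stable_class N) (var_dist N)"
  by (rule Metric_space.subspace[OF Metric_space_NBV]) (auto simp: stable_class_def)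

end

theory Submission
  imports Defs "HOL-Complex_Analysis.Conformal_Mappings"
begin

text \<open>Every entry of the integral of a bounded function against \<open>dM\<close> is bounded by a multiple of
  \<open>Var(M)\<close>, and \<open>\<bar>exp(s\<theta>)\<bar> \<le> exp \<bar>\<alpha>\<bar>\<close> for \<open>Re s \<ge> \<alpha>\<close> and \<open>\<theta> \<in> [-1, 0]\<close>. Since the determinant is uniformly
  continuous on bounded sets of matrices, the characteristic functions \<open>\<Delta>\<close> therefore depend
  continuously on \<open>M\<close>, uniformly on every half plane \<open>Re s \<ge> \<alpha>\<close>. If \<open>\<alpha> > S\<^sub>M\<close>, then \<open>\<bar>\<Delta>\<^sub>M\<bar>\<close> has a
  positive lower bound on \<open>Re s \<ge> \<alpha>\<close>, so nearby functions have no zeros there (upper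
  semicontinuity). Conversely \<open>\<Delta>\<^sub>M\<close> is entire and not identically zero because \<open>S\<^sub>M < \<infinity>\<close>, so its zeros
  are isolated and, by the minimum modulus principle, persist under small perturbations (lower
  semicontinuity).\<close>

section \<open>Finite measures on the interval\<close>

definition finite_measure_on_I :: "real measure \<Rightarrow> bool" where
  "finite_measure_on_I P \<longleftrightarrow> finite_measure P \<and> sets P = sets borel_I"

lemma finite_measure_on_I_D:
  assumes "finite_measure_on_I P"
  shows "finite_measure P" "sets P = sets borel_I" "space P = {-1..0}"
proof -
  show 1: "finite_measure P" "sets P = sets borel_I"
    using assms by (auto simp: finite_measure_on_I_def)
  show "space P = {-1..0}"
    using sets_eq_imp_space_eq[OF 1(2)] by (simp add: space_restrict_space)
qed

lemma sets_borel_I_iff: "E \<in> sets borel_I \<longleftrightarrow> E \<subseteq> {-1..0} \<and> E \<in> sets borel"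
  by (rule sets_restrict_space_iff) auto

text \<open>The generator consists of exactly the intervals on which \<open>measure_of_NBV\<close>
  prescribes values. The set \<open>{-1}\<close> is not among them, because
  \<open>M (-1) = 0\<close> is a normalization and not the mass of the atom at -1.\<close>

lemma sets_borel_I_generated:
  "sets borel_I = sigma_sets {-1..0} ((\<lambda>t::real. {-1..t}) ` {-1<..0})"
proof -
  let ?G = "(\<lambda>t::real. {-1..t}) ` {-1<..0}"
  have sp: "?G \<subseteq> Pow {-1..0}" by auto
  have "sets borel_I = (\<inter>) {-1..0} ` sigma_sets UNIV (range (\<lambda>a::real. {..a}))"
    by (simp add: sets_restrict_space borel_eq_atMost)
  also have "\<dots> = sigma_sets {-1..0} ((\<inter>) {-1..0} ` range (\<lambda>a::real. {..a}))"
  proof (rule sigma_sets_Int)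
    have "({-1..0}::real set) \<in> sets borel" by simp
    then show "({-1..0}::real set) \<in> sigma_sets UNIV (range (\<lambda>a. {..a}))"
      by (subst (asm) borel_eq_atMost) simp
  qed simp
  also have "\<dots> = sigma_sets {-1..0} ?G"
  proof (rule sigma_sets_eqI)
    fix a assume "a \<in> (\<inter>) {-1..0} ` range (\<lambda>a::real. {..a})"
    then obtain t where a: "a = {-1..0} \<inter> {..t}" by (elim imageE) blast
    consider "t < -1" | "t = -1" | "-1 < t" "t \<le> 0" | "t > 0" by linarith
    then show "a \<in> sigma_sets {-1..0} ?G"
    proof cases
      case 1
      then have "a = {}" using a by auto
      then show ?thesis by (simp add: sigma_sets.Empty)
    next
      case 2
      \<comment> \<open>The singleton is recovered as a countable intersection of generators;
        \<open>n + 1\<close> in the denominator keeps every right end point in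
        \<open>{-1<..0}\<close>, also for \<open>n = 0\<close>.\<close>
      have "a = (\<Inter>n::nat. {-1..-1 + 1 / (real n + 1)})"
      proof
        show "a \<subseteq> (\<Inter>n::nat. {-1..-1 + 1 / (real n + 1)})" using 2 a by auto
        show "(\<Inter>n::nat. {-1..-1 + 1 / (real n + 1)}) \<subseteq> a"
        proof
          fix x :: real assume x: "x \<in> (\<Inter>n::nat. {-1..-1 + 1 / (real n + 1)})"
          have "\<not> -1 < x"
          proof
            assume "-1 < x"
            then obtain n :: nat where "1 / (x + 1) < real n" using reals_Archimedean2 by blast
            with \<open>-1 < x\<close> have "1 / (real n + 1) < x + 1" by (simp add: field_simps)
            with x show False by (auto dest!: spec[of _ n])
          qed
          moreover have "-1 \<le> x" using x by auto
          ultimately show "x \<in> a" using 2 a by auto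
        qed
      qed
      moreover have "{-1..-1 + 1 / (real n + 1)} \<in> sigma_sets {-1..0} ?G" for n
        by (rule sigma_sets.Basic) auto
      ultimately show ?thesis using sigma_sets_Inter[OF sp] by simp
    next
      case 3
      then have "a = {-1..t}" using a by auto
      then show ?thesis using 3 by auto
    next
      case 4
      then have "a = {-1..0}" using a by auto
      then show ?thesis by auto
    qed
  next
    fix b assume "b \<in> ?G"
    then obtain t where t: "b = {-1..t}" "-1 < t" "t \<le> 0" by auto
    then have "b = {-1..0} \<inter> {..t}" by auto
    then show "b \<in> sigma_sets {-1..0} ((\<inter>) {-1..0} ` range (\<lambda>a::real. {..a}))"
      by (metis imageI rangeI sigma_sets.Basic)
  qed
  finally show ?thesis .
qed

section \<open>Uniqueness of measures and integrals from their values on intervals\<close>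

text \<open>Dynkin's pi-lambda argument: the intervals are stable under intersection, and the sets
  on which \<open>\<nu>\<close> vanishes are closed under complements and disjoint countable unions.
  Values in a normed space cover signed and matrix-valued set functions alike; applied to a
  difference, the lemma gives uniqueness.\<close>

lemma countably_additive_eq_0:
  fixes \<nu> :: "real set \<Rightarrow> 'a::real_normed_vector"
  assumes ca: "\<And>A :: nat \<Rightarrow> real set. range A \<subseteq> sets borel_I \<Longrightarrow> disjoint_family A \<Longrightarrow>
      (\<lambda>i. \<nu> (A i)) sums \<nu> (\<Union>i. A i)"
    and gen: "\<And>t. t \<in> {-1<..0} \<Longrightarrow> \<nu> {-1..t} = 0"
    and E: "E \<in> sets borel_I"
  shows "\<nu> E = 0"
proof -
  let ?G = "(\<lambda>t::real. {-1..t}) ` {-1<..0}"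
  \<comment> \<open>A sequence of empty sets is disjoint, and a constant series converges only if
    its term is zero.\<close>
  have "(\<lambda>i::nat. \<nu> {}) sums \<nu> {}"
    using ca[of "\<lambda>_. {}"] by (simp add: disjoint_family_on_def)
  then have empty: "\<nu> {} = 0" using summable_const_iff sums_summable by blast
  have add: "\<nu> (A \<union> B) = \<nu> A + \<nu> B"
    if "A \<in> sets borel_I" "B \<in> sets borel_I" "A \<inter> B = {}" for A B
  proof -
    have "(\<lambda>i. \<nu> (binaryset A B i)) sums \<nu> (\<Union>i. binaryset A B i)"
      using that by (intro ca) (auto simp: range_binaryset_eq disjoint_family_on_def binaryset_def)
    moreover have "(\<lambda>i. \<nu> (binaryset A B i)) sums (\<nu> A + \<nu> B)"
      by (rule binaryset_sums) (rule empty)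
    ultimately show ?thesis by (simp add: UN_binaryset_eq sums_unique2)
  qed
  have "Int_stable ?G" by (auto simp: Int_stable_def min_def)
  moreover have "?G \<subseteq> Pow {-1..0}" by auto
  moreover have "E \<in> sigma_sets {-1..0} ?G" using E by (simp add: sets_borel_I_generated)
  ultimately show ?thesis
  proof (induction rule: sigma_sets_induct_disjoint)
    case (basic A)
    then show ?case using gen by auto
  next
    case (compl A)
    have A: "A \<in> sets borel_I" using compl by (simp add: sets_borel_I_generated)
    then have "A \<subseteq> {-1..0}" by (simp add: sets_borel_I_iff)
    then have "A \<union> ({-1..0} - A) = {-1..0}" by auto
    moreover have "{-1..0} - A \<in> sets borel_I" using A by (auto simp: sets_borel_I_iff)
    ultimately have "\<nu> {-1..0} = \<nu> A + \<nu> ({-1..0} - A)" using add[OF A, of "{-1..0} - A"] by auto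
    then show ?case using gen[of 0] compl by simp
  next
    case (union A)
    then have "(\<lambda>i. \<nu> (A i)) sums \<nu> (\<Union>i. A i)" by (intro ca) (auto simp: sets_borel_I_generated)
    then show ?case using union by (simp add: sums_iff)
  qed (rule empty)
qed

lemma tendsto_sum_list:
  fixes f :: "'a \<Rightarrow> 'b \<Rightarrow> 'c::topological_comm_monoid_add"
  assumes "\<And>x. x \<in> set xs \<Longrightarrow> (f x \<longlongrightarrow> l x) F"
  shows "((\<lambda>i. \<Sum>x\<leftarrow>xs. f x i) \<longlongrightarrow> (\<Sum>x\<leftarrow>xs. l x)) F"
  using assms by (induction xs) (auto intro!: tendsto_add)

lemma sums_sum_list:
  fixes f :: "'a \<Rightarrow> nat \<Rightarrow> 'c::{topological_comm_monoid_add, t2_space}"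
  assumes "\<And>x. x \<in> set xs \<Longrightarrow> f x sums l x"
  shows "(\<lambda>i. \<Sum>x\<leftarrow>xs. f x i) sums (\<Sum>x\<leftarrow>xs. l x)"
  using assms by (induction xs) (auto intro!: sums_add)

text \<open>Signed combinations of measures are represented as lists of pairs (coefficient, measure),
  as the sum of two measures is not available as a measure.\<close>

lemma lincomb_measure_eq_0:
  fixes xs :: "(real \<times> real measure) list"
  assumes fin: "\<And>x. x \<in> set xs \<Longrightarrow> finite_measure_on_I (snd x)"
    and gen: "\<And>t. t \<in> {-1<..0} \<Longrightarrow> (\<Sum>x\<leftarrow>xs. fst x * measure (snd x) {-1..t}) = 0"
    and E: "E \<in> sets borel_I"
  shows "(\<Sum>x\<leftarrow>xs. fst x * measure (snd x) E) = 0"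
proof (rule countably_additive_eq_0[where \<nu> = "\<lambda>E. \<Sum>x\<leftarrow>xs. fst x * measure (snd x) E", OF _ gen E])
  fix A :: "nat \<Rightarrow> real set"
  assume A: "range A \<subseteq> sets borel_I" "disjoint_family A"
  show "(\<lambda>i. \<Sum>x\<leftarrow>xs. fst x * measure (snd x) (A i)) sums (\<Sum>x\<leftarrow>xs. fst x * measure (snd x) (\<Union>i. A i))"
    using A finite_measure_on_I_D[OF fin]
    by (intro sums_sum_list sums_mult finite_measure.finite_measure_UNION) auto
qed

text \<open>The usual passage from sets to functions: for simple functions the claim is
  \<open>lincomb_measure_eq_0\<close> on level sets, and bounded measurable functions follow by
  dominated convergence. Identities between integrals thereby reduce to a check on
  intervals.\<close>

lemma lincomb_integral_eq_0:
  fixes xs :: "(real \<times> real measure) list" and f :: "real \<Rightarrow> complex"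
  assumes fin: "\<And>x. x \<in> set xs \<Longrightarrow> finite_measure_on_I (snd x)"
    and gen: "\<And>t. t \<in> {-1<..0} \<Longrightarrow> (\<Sum>x\<leftarrow>xs. fst x * measure (snd x) {-1..t}) = 0"
    and f: "f \<in> borel_measurable borel_I" and B: "\<And>x. x \<in> {-1..0} \<Longrightarrow> cmod (f x) \<le> B"
  shows "(\<Sum>x\<leftarrow>xs. fst x *\<^sub>R integral\<^sup>L (snd x) f) = 0"
proof -
  note D = finite_measure_on_I_D[OF fin]
  have spI: "space borel_I = {-1..0}" by (simp add: space_restrict_space)
  have simple: "(\<Sum>x\<leftarrow>xs. fst x *\<^sub>R integral\<^sup>L (snd x) g) = 0"
    if g: "simple_function borel_I g" for g :: "real \<Rightarrow> complex"
  proof -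
    have int: "integral\<^sup>L (snd x) g
        = (\<Sum>y\<in>g ` {-1..0}. measure (snd x) {t\<in>{-1..0}. g t = y} *\<^sub>R y)" if x: "x \<in> set xs" for x
    proof -
      have "simple_function (snd x) g"
        using g D[OF x] simple_function_cong_algebra[of "snd x" borel_I g] by (simp add: spI)
      moreover have "emeasure (snd x) {y \<in> space (snd x). g y \<noteq> 0} \<noteq> \<infinity>"
        using finite_measure.emeasure_finite[OF D(1)[OF x]] by simp
      ultimately have "Bochner_Integration.simple_bochner_integrable (snd x) g"
        by (rule simple_bochner_integrable.intros)
      then have "integral\<^sup>L (snd x) g = Bochner_Integration.simple_bochner_integral (snd x) g"
        by (rule simple_bochner_integrable_eq_integral[symmetric])
      then show ?thesis by (simp add: Bochner_Integration.simple_bochner_integral_def D(3)[OF x])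
    qed
    have "(\<Sum>x\<leftarrow>xs. fst x *\<^sub>R integral\<^sup>L (snd x) g)
        = (\<Sum>x\<leftarrow>xs. fst x *\<^sub>R (\<Sum>y\<in>g ` {-1..0}. measure (snd x) {t\<in>{-1..0}. g t = y} *\<^sub>R y))"
      using int by (intro arg_cong[where f = sum_list] map_cong) simp_all
    also have "\<dots> = (\<Sum>y\<in>g ` {-1..0}. (\<Sum>x\<leftarrow>xs. fst x * measure (snd x) {t\<in>{-1..0}. g t = y}) *\<^sub>R y)"
      by (induction xs) (simp_all add: sum.distrib scaleR_sum_right scaleR_add_left)
    also have "\<dots> = (\<Sum>y\<in>g ` {-1..0}. 0 *\<^sub>R y)"
    proof (intro sum.cong arg_cong2[where f = scaleR] refl lincomb_measure_eq_0[OF fin gen])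
      fix y
      have "g -` {y} \<inter> space borel_I \<in> sets borel_I" by (rule simple_functionD(2)[OF g])
      moreover have "g -` {y} \<inter> space borel_I = {t\<in>{-1..0}. g t = y}" by (auto simp: spI)
      ultimately show "{t\<in>{-1..0}. g t = y} \<in> sets borel_I" by simp
    qed auto
    finally show ?thesis by simp
  qed
  \<comment> \<open>The approximating simple functions satisfy
    \<open>cmod (F i x) \<le> 2 * cmod (f x)\<close>, which is the source of the dominating constant
    \<open>2 * B\<close>.\<close>
  obtain F where F: "\<And>i. simple_function borel_I (F i)"
    "\<And>x. x \<in> space borel_I \<Longrightarrow> (\<lambda>i. F i x) \<longlonglongrightarrow> f x"
    "\<And>i x. x \<in> space borel_I \<Longrightarrow> dist (F i x) 0 \<le> 2 * dist (f x) 0"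
    using borel_measurable_implies_sequence_metric[OF f, of 0] by blast
  have "(\<lambda>i. \<Sum>x\<leftarrow>xs. fst x *\<^sub>R integral\<^sup>L (snd x) (F i)) \<longlonglongrightarrow> (\<Sum>x\<leftarrow>xs. fst x *\<^sub>R integral\<^sup>L (snd x) f)"
  proof (intro tendsto_sum_list tendsto_scaleR tendsto_const)
    fix x assume x: "x \<in> set xs"
    interpret finite_measure "snd x" by (rule D(1)[OF x])
    have cong: "borel_measurable (snd x) = (borel_measurable borel_I :: (real \<Rightarrow> complex) set)"
      by (rule measurable_cong_sets[OF D(2)[OF x] refl])
    show "(\<lambda>i. integral\<^sup>L (snd x) (F i)) \<longlonglongrightarrow> integral\<^sup>L (snd x) f"
    proof (rule integral_dominated_convergence[where w = "\<lambda>_. 2 * B"])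
      show "f \<in> borel_measurable (snd x)" using f cong by simp
      show "F i \<in> borel_measurable (snd x)" for i
        using borel_measurable_simple_function[OF F(1)] cong by simp
      show "AE t in snd x. (\<lambda>i. F i t) \<longlonglongrightarrow> f t"
        using F(2) by (intro AE_I2) (simp add: D(3)[OF x] spI)
      show "AE t in snd x. norm (F i t) \<le> 2 * B" for i
      proof (intro AE_I2)
        fix t assume "t \<in> space (snd x)"
        then have t: "t \<in> {-1..0}" by (simp add: D(3)[OF x])
        then show "norm (F i t) \<le> 2 * B" using F(3)[of t i] B[OF t] by (simp add: spI)
      qed
    qed auto
  qed
  moreover have "(\<Sum>x\<leftarrow>xs. fst x *\<^sub>R integral\<^sup>L (snd x) (F i)) = 0" for i by (rule simple[OF F(1)])
  ultimately show ?thesis by (simp add: LIMSEQ_const_iff)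
qed

section \<open>Jordan decomposition of a difference of finite measures\<close>

text \<open>\<open>Y\<close> is the positive set of a Hahn decomposition of \<open>P - Q\<close>. A
  raw \<open>measure_of\<close> has the intended values only if its set function is a measure; here
  the supremum agrees with an existing measure \<open>R\<close>, the restriction of
  \<open>P - Q\<close> to \<open>Y\<close>.\<close>

lemma positive_part_Hahn:
  assumes P: "finite_measure_on_I P" and Q: "finite_measure_on_I Q"
    and \<nu>: "\<And>E. E \<in> sets borel_I \<Longrightarrow> \<nu> E = measure P E - measure Q E"
    and Y: "Y \<in> sets borel_I"
    and pos: "\<And>X. X \<in> sets borel_I \<Longrightarrow> X \<subseteq> Y \<Longrightarrow> 0 \<le> \<nu> X"
    and neg: "\<And>X. X \<in> sets borel_I \<Longrightarrow> X \<inter> Y = {} \<Longrightarrow> \<nu> X \<le> 0"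
  shows "finite_measure_on_I (positive_part \<nu>)"
    and "\<And>E. E \<in> sets borel_I \<Longrightarrow> measure (positive_part \<nu>) E = \<nu> (E \<inter> Y)"
proof -
  note PD = finite_measure_on_I_D[OF P] and QD = finite_measure_on_I_D[OF Q]
  interpret P: finite_measure P by (rule PD)
  interpret Q: finite_measure Q by (rule QD)
  txt \<open>The supremum in the definition of the positive part is attained at \<open>E \<inter> Y\<close>.\<close>
  define P' where "P' = density P (indicator Y)"
  define Q' where "Q' = density Q (indicator Y)"
  \<comment> \<open>The subtraction is legitimate because both measures have been cut down to
    \<open>Y\<close>, where \<open>Q\<close> is dominated by \<open>P\<close>.\<close>
  define R where "R = diff_measure P' Q'"
  have P': "emeasure P' E = ennreal (measure P (E \<inter> Y))" if "E \<in> sets borel_I" for E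
    using that Y by (simp add: P'_def emeasure_restricted PD P.emeasure_eq_measure Int_commute)
  have Q': "emeasure Q' E = ennreal (measure Q (E \<inter> Y))" if "E \<in> sets borel_I" for E
    using that Y by (simp add: Q'_def emeasure_restricted QD Q.emeasure_eq_measure Int_commute)
  have s: "sets P' = sets borel_I" "sets Q' = sets borel_I" "space P' = {-1..0}" "space Q' = {-1..0}"
    by (simp_all add: P'_def Q'_def PD QD)
  have I: "{-1..0} \<in> sets borel_I" by (auto simp: sets_borel_I_iff)
  have fin: "finite_measure P'" "finite_measure Q'"
    by (auto intro!: finite_measureI simp: s P'[OF I] Q'[OF I])
  have R: "emeasure R E = ennreal (\<nu> (E \<inter> Y))" if E: "E \<in> sets borel_I" for E
  proof -
    have EY: "A \<inter> Y \<in> sets borel_I" if "A \<in> sets borel_I" for A using that Y by auto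
    have "emeasure R E = emeasure P' E - emeasure Q' E"
      unfolding R_def
    proof (rule emeasure_diff_measure[OF fin])
      fix A assume "A \<in> sets P'"
      then have A: "A \<in> sets borel_I" by (simp add: s)
      show "emeasure Q' A \<le> emeasure P' A"
        using pos[OF EY[OF A]] \<nu>[OF EY[OF A]] by (simp add: P'[OF A] Q'[OF A] ennreal_leI)
    qed (use s E in auto)
    then show ?thesis using \<nu>[OF EY[OF E]] by (simp add: P'[OF E] Q'[OF E] ennreal_minus)
  qed
  have sup: "(SUP F\<in>{F \<in> sets borel_I. F \<subseteq> E}. ennreal (\<nu> F)) = emeasure R E"
    if E: "E \<in> sets borel_I" for E
    unfolding R[OF E]
  proof (rule antisym[OF SUP_least SUP_upper])
    fix F assume F: "F \<in> {F \<in> sets borel_I. F \<subseteq> E}"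
    have m: "F \<inter> Y \<in> sets borel_I" "F - Y \<in> sets borel_I" "E \<inter> Y - F \<in> sets borel_I" "E \<inter> Y \<in> sets borel_I"
      using F E Y by auto
    \<comment> \<open>Dropping the part of \<open>F\<close> outside \<open>Y\<close> and then
      filling up to \<open>E \<inter> Y\<close> can only increase \<open>\<nu>\<close>.\<close>
    have "\<nu> F = \<nu> (F \<inter> Y) + \<nu> (F - Y)"
      using F P.finite_measure_Union[of "F \<inter> Y" "F - Y"] Q.finite_measure_Union[of "F \<inter> Y" "F - Y"] m
      by (auto simp: \<nu> PD QD Int_Diff_Un Int_Diff_disjoint)
    also have "\<dots> \<le> \<nu> (F \<inter> Y)" using neg[OF m(2)] by auto
    also have "\<dots> \<le> \<nu> (F \<inter> Y) + \<nu> (E \<inter> Y - F)" using pos[OF m(3)] by auto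
    also have "\<dots> = \<nu> (E \<inter> Y)"
    proof -
      have "(F \<inter> Y) \<union> (E \<inter> Y - F) = E \<inter> Y" using F by auto
      then show ?thesis
        using P.finite_measure_Union[of "F \<inter> Y" "E \<inter> Y - F"] Q.finite_measure_Union[of "F \<inter> Y" "E \<inter> Y - F"] m
        by (auto simp: \<nu> PD QD Int_Diff_disjoint disjoint_iff)
    qed
    finally show "ennreal (\<nu> F) \<le> ennreal (\<nu> (E \<inter> Y))" by (rule ennreal_leI)
  qed (use E Y in auto)
  have "positive_part \<nu> = measure_of {-1..0} (sets borel_I) (emeasure R)"
    unfolding positive_part_def
  proof (rule measure_of_eq)
    show "sets borel_I \<subseteq> Pow {-1..0}" using sets_borel_I_iff by blast
    fix E assume "E \<in> sigma_sets {-1..0} (sets borel_I)"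
    then have "E \<in> sets borel_I"
      using sets.sigma_sets_eq[of borel_I] by (simp add: space_restrict_space)
    then show "(SUP F\<in>{F \<in> sets borel_I. F \<subseteq> E}. ennreal (\<nu> F)) = emeasure R E" by (rule sup)
  qed
  also have "\<dots> = R"
    using measure_of_of_measure[of R] s by (simp add: R_def)
  finally have eq: "positive_part \<nu> = R" .
  show "finite_measure_on_I (positive_part \<nu>)"
    unfolding eq finite_measure_on_I_def
    using I R[OF I] s by (auto intro!: finite_measureI simp: R_def)
  fix E assume E: "E \<in> sets borel_I"
  have "E \<inter> Y \<in> sets borel_I" using E Y by auto
  then have "0 \<le> \<nu> (E \<inter> Y)" by (rule pos) auto
  then show "measure (positive_part \<nu>) E = \<nu> (E \<inter> Y)"
    unfolding eq by (simp add: measure_def R[OF E])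
qed

text \<open>The positive and negative parts live on the two halves of a Hahn decomposition and their
  difference agrees with \<open>P - Q\<close> on intervals, hence under the integral. From here on
  any representation of \<open>\<nu>\<close> as a difference of finite measures may replace the
  Jordan decomposition.\<close>

lemma signed_integral_diff:
  assumes P: "finite_measure_on_I P" and Q: "finite_measure_on_I Q"
    and \<nu>: "\<And>E. E \<in> sets borel_I \<Longrightarrow> \<nu> E = measure P E - measure Q E"
    and f: "f \<in> borel_measurable borel_I" and B: "\<And>x. x \<in> {-1..0} \<Longrightarrow> cmod (f x) \<le> B"
  shows "signed_integral \<nu> f = integral\<^sup>L P f - integral\<^sup>L Q f"
proof -
  note PD = finite_measure_on_I_D[OF P] and QD = finite_measure_on_I_D[OF Q]
  interpret P: finite_measure P by (rule PD)
  interpret Q: finite_measure Q by (rule QD)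
  obtain Y where Y: "Y \<in> sets P" "\<And>X. X \<in> sets P \<Longrightarrow> X \<subseteq> Y \<Longrightarrow> emeasure Q X \<le> emeasure P X"
    "\<And>X. X \<in> sets P \<Longrightarrow> X \<inter> Y = {} \<Longrightarrow> emeasure P X \<le> emeasure Q X"
    using finite_unsigned_Hahn_decomposition[OF PD(1) QD(1)] PD(2) QD(2) by auto
  have YI: "Y \<in> sets borel_I" "{-1..0} - Y \<in> sets borel_I"
    using Y(1) PD(2) by (auto simp: sets_borel_I_iff)
  have pos: "0 \<le> \<nu> X" if "X \<in> sets borel_I" "X \<subseteq> Y" for X
    using Y(2)[of X] that by (simp add: PD P.emeasure_eq_measure Q.emeasure_eq_measure \<nu>)
  have neg: "\<nu> X \<le> 0" if "X \<in> sets borel_I" "X \<inter> Y = {}" for X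
    using Y(3)[of X] that by (simp add: PD P.emeasure_eq_measure Q.emeasure_eq_measure \<nu>)
  let ?R = "positive_part \<nu>" and ?S = "positive_part (\<lambda>E. - \<nu> E)"
  have R: "finite_measure_on_I ?R" "\<And>E. E \<in> sets borel_I \<Longrightarrow> measure ?R E = \<nu> (E \<inter> Y)"
    using positive_part_Hahn[where \<nu> = \<nu>, OF P Q _ YI(1)] \<nu> pos neg by blast+
  have S: "finite_measure_on_I ?S" "\<And>E. E \<in> sets borel_I \<Longrightarrow> measure ?S E = - \<nu> (E \<inter> ({-1..0} - Y))"
  proof -
    have 1: "- \<nu> E = measure Q E - measure P E" if "E \<in> sets borel_I" for E using \<nu>[OF that] by simp
    have 2: "0 \<le> - \<nu> X" if "X \<in> sets borel_I" "X \<subseteq> {-1..0} - Y" for X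
      using neg[of X] that by auto
    have 3: "- \<nu> X \<le> 0" if X: "X \<in> sets borel_I" "X \<inter> ({-1..0} - Y) = {}" for X
    proof -
      have "X \<subseteq> Y" using X by (auto simp: sets_borel_I_iff)
      then show ?thesis using pos[OF X(1)] by simp
    qed
    show "finite_measure_on_I ?S" "\<And>E. E \<in> sets borel_I \<Longrightarrow> measure ?S E = - \<nu> (E \<inter> ({-1..0} - Y))"
      using positive_part_Hahn[where \<nu> = "\<lambda>E. - \<nu> E", OF Q P _ YI(2)] 1 2 3 by blast+
  qed
  have "(\<Sum>x\<leftarrow>[(1,?R), (-1,?S), (-1,P), (1,Q)]. fst x *\<^sub>R integral\<^sup>L (snd x) f) = 0"
  proof (rule lincomb_integral_eq_0[OF _ _ f B])
    fix t :: real assume t: "t \<in> {-1<..0}"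
    have m: "{-1..t} \<in> sets borel_I" using t by (auto simp: sets_borel_I_iff)
    have m': "{-1..t} \<inter> Y \<in> sets borel_I" "{-1..t} \<inter> ({-1..0} - Y) \<in> sets borel_I"
      using m YI by blast+
    have e: "({-1..t} \<inter> Y) \<union> ({-1..t} \<inter> ({-1..0} - Y)) = {-1..t}" using t by auto
    have "({-1..t} \<inter> Y) \<inter> ({-1..t} \<inter> ({-1..0} - Y)) = {}" by auto
    then have "\<nu> {-1..t} = \<nu> ({-1..t} \<inter> Y) + \<nu> ({-1..t} \<inter> ({-1..0} - Y))"
      using m m' P.finite_measure_Union[of "{-1..t} \<inter> Y" "{-1..t} \<inter> ({-1..0} - Y)"]
         Q.finite_measure_Union[of "{-1..t} \<inter> Y" "{-1..t} \<inter> ({-1..0} - Y)"]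
      unfolding e by (simp add: \<nu> PD QD)
    then show "(\<Sum>x\<leftarrow>[(1,?R), (-1,?S), (-1,P), (1,Q)]. fst x * measure (snd x) {-1..t}) = 0"
      using R(2)[OF m] S(2)[OF m] \<nu>[OF m] by simp
  qed (use P Q R(1) S(1) in auto)
  then show ?thesis by (simp add: signed_integral_def algebra_simps)
qed

section \<open>Measures from increasing functions\<close>

text \<open>The function \<open>F\<close> of right limits of \<open>V\<close> is increasing and
  right continuous, so it has a Lebesgue-Stieltjes measure. The conclusion speaks of right limits
  because \<open>V\<close> may jump at \<open>t\<close>.\<close>

lemma Stieltjes_measure_on_I:
  fixes V :: "real \<Rightarrow> real"
  assumes mono: "mono V" and left: "\<And>t. t < -1 \<Longrightarrow> V t = 0"
  obtains P where "finite_measure_on_I P"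
    "\<And>t. t \<in> {-1<..0} \<Longrightarrow> (V \<longlongrightarrow> measure P {-1..t}) (at_right t)"
proof -
  define F where "F t = Inf (V ` {t<..})" for t
  have bdd: "bdd_below (V ` {t<..})" for t
    using mono by (intro bdd_belowI[of _ "V t"]) (auto simp: mono_def)
  have VF: "(V \<longlongrightarrow> F t) (at_right t)" for t
    using Lim_right_bound[of UNIV t V "V t"] mono by (simp add: F_def mono_def less_imp_le)
  have F_le: "F t \<le> V s" if "t < s" for s t
    unfolding F_def using bdd that by (intro cInf_lower) auto
  have V_le: "V t \<le> F t" for t
    unfolding F_def using mono by (intro cInf_greatest) (auto simp: mono_def)
  have F_mono: "F x \<le> F y" if "x \<le> y" for x y
    unfolding F_def using that bdd by (intro cInf_superset_mono) auto
  have F_cont: "continuous (at_right a) F" for a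
    unfolding continuous_within
  proof (rule order_tendstoI)
    fix l assume "l < F a"
    then show "\<forall>\<^sub>F x in at_right a. l < F x"
      using F_mono[of a] by (auto simp: eventually_at_filter intro!: always_eventually intro: less_le_trans)
  next
    fix u assume "F a < u"
    then have "\<forall>\<^sub>F x in at_right a. V x < u" by (rule order_tendstoD(2)[OF VF])
    then obtain b where b: "a < b" "\<And>y. a < y \<Longrightarrow> y < b \<Longrightarrow> V y < u"
      by (auto simp: eventually_at_right_field)
    \<comment> \<open>A point \<open>y\<close> strictly between \<open>x\<close> and
      \<open>b\<close> gives \<open>F x \<le> V y < u\<close>.\<close>
    have "F x < u" if x: "a < x" "x < b" for x
    proof -
      obtain y where y: "x < y" "y < b" using dense[OF x(2)] by blast
      then show ?thesis using F_le[of x y] b(2)[of y] x by linarith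
    qed
    then show "\<forall>\<^sub>F x in at_right a. F x < u" using b(1) by (auto simp: eventually_at_right_field)
  qed
  \<comment> \<open>The point -2 only serves as a base point left of -1: since \<open>F\<close>
    vanishes there, \<open>{-2<..t}\<close> has mass \<open>F t\<close>.\<close>
  have F2: "F (-2) = 0"
    using F_le[of "-2" "-3/2"] V_le[of "-2"] left by simp
  txt \<open>Pushing forward along \<open>max (-1)\<close> moves the mass on \<open>(-2, -1]\<close>, which is the jump of \<open>F\<close>
    at \<open>-1\<close>, into the atom \<open>{-1}\<close>.\<close>
  let ?J = "restrict_space (interval_measure F) {-2<..0}"
  define P where "P = distr ?J borel_I (max (-1))"
  have meas: "max (-1) \<in> measurable ?J borel_I"
    by (rule measurable_restrict_space2) (auto simp: space_restrict_space intro!: measurable_restrict_space1)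
  have P: "emeasure P {-1..t} = ennreal (F t)" if t: "-1 < t" "t \<le> 0" for t
  proof -
    have "{-1..t} \<in> sets borel_I" using t by (auto simp: sets_borel_I_iff)
    then have "emeasure P {-1..t} = emeasure ?J (max (-1) -` {-1..t} \<inter> space ?J)"
      unfolding P_def by (rule emeasure_distr[OF meas])
    also have "max (-1) -` {-1..t} \<inter> space ?J = {-2<..t}" using t by (auto simp: space_restrict_space)
    also have "emeasure ?J {-2<..t} = emeasure (interval_measure F) {-2<..t}"
      using t by (intro emeasure_restrict_space) auto
    also have "\<dots> = ennreal (F t)"
      using emeasure_interval_measure_Ioc[OF _ F_mono F_cont, of "-2" t] t F2 by simp
    finally show ?thesis .
  qed
  show ?thesis
  proof
    show "finite_measure_on_I P"
      unfolding finite_measure_on_I_def using P[of 0]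
      by (auto intro!: finite_measureI simp: P_def space_restrict_space)
    fix t :: real assume t: "t \<in> {-1<..0}"
    have "0 \<le> F t" using F_mono[of "-2" t] F2 t by simp
    then have "measure P {-1..t} = F t" using P[of t] t by (simp add: measure_def)
    then show "(V \<longlongrightarrow> measure P {-1..t}) (at_right t)" using VF by simp
  qed
qed

section \<open>Functions of bounded variation as differences of measures\<close>

text \<open>Partitions of \<open>[-1, s]\<close>, so that \<open>chains 0\<close> is
  \<open>partitions\<close>. The case \<open>k = 0\<close> occurs exactly for \<open>s = -1\<close>,
  where it provides a chain with an empty sum.\<close>

definition chains :: "real \<Rightarrow> ((nat \<Rightarrow> real) \<times> nat) set" where
  "chains s = {(t, k). t 1 = -1 \<and> t (k + 1) = s \<and> (\<forall>i\<in>{1..k}. t i < t (i + 1))}"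

text \<open>\<open>W s\<close> is the variation of \<open>D\<close> over \<open>[-1, s]\<close>.
  Appending a point \<open>y\<close> to a chain ending at \<open>x\<close> adds exactly the term for
  the increment from \<open>x\<close> to \<open>y\<close>, so \<open>W\<close> grows at least by
  that term.\<close>

lemma variation_function:
  assumes N: "is_norm N" and fin: "total_variation N D < \<infinity>"
  obtains W :: "real \<Rightarrow> real" where
    "\<And>x y. -1 \<le> x \<Longrightarrow> x \<le> y \<Longrightarrow> y \<le> 0 \<Longrightarrow> matrix_norm N (D y - D x) \<le> W y - W x"
    "\<And>x. x \<in> {-1..0} \<Longrightarrow> 0 \<le> W x"
    "W 0 \<le> enn2real (total_variation N D)"
proof -
  define S where "S c = (\<Sum>i=1..snd c. matrix_norm N (D (fst c (i + 1)) - D (fst c i)))"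
    for c :: "(nat \<Rightarrow> real) \<times> nat"
  define W where "W s = (SUP c\<in>chains s. S c)" for s
  let ?v = "enn2real (total_variation N D)"
  have S0: "0 \<le> S c" for c
    unfolding S_def by (intro sum_nonneg matrix_norm_nonneg N)
  have S_le: "S c \<le> ?v" if "c \<in> chains 0" for c
  proof -
    have "c \<in> partitions" using that by (simp add: chains_def partitions_def)
    then have "ennreal (S c) \<le> total_variation N D"
      unfolding total_variation_def S_def by (rule SUP_upper2) (simp add: case_prod_beta)
    then have "enn2real (ennreal (S c)) \<le> ?v" using fin by (intro enn2real_mono) auto
    then show ?thesis using S0 by simp
  qed
  have extend: "\<exists>c'\<in>chains y. S c' = S c + matrix_norm N (D y - D x)"
    if c: "c \<in> chains x" and xy: "x < y" for c x y
  proof -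
    obtain t k where c': "c = (t, k)" by (cases c)
    \<comment> \<open>Indices start at 1, so the old end point has index \<open>k + 1\<close> and
      the new one gets index \<open>k + 2\<close>.\<close>
    define t' where "t' = t(k + 2 := y)"
    have tk: "t 1 = -1" "t (k + 1) = x" "\<And>i. i \<in> {1..k} \<Longrightarrow> t i < t (i + 1)"
      using c by (auto simp: c' chains_def)
    have "t' i < t' (i + 1)" if "i \<in> {1..k + 1}" for i
      using that tk(2) tk(3)[of i] xy by (cases "i = k + 1") (auto simp: t'_def)
    then have "(t', k + 1) \<in> chains y" using tk by (auto simp: chains_def t'_def)
    moreover have "S (t', k + 1) = S c + matrix_norm N (D y - D x)"
    proof -
      have "(\<Sum>i=1..k. matrix_norm N (D (t' (i + 1)) - D (t' i)))
          = (\<Sum>i=1..k. matrix_norm N (D (t (i + 1)) - D (t i)))"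
        by (intro sum.cong) (auto simp: t'_def)
      then show ?thesis using tk(2) by (simp add: S_def c' t'_def)
    qed
    ultimately show ?thesis by blast
  qed
  have chains_ne: "chains x \<noteq> {}" if "-1 \<le> x" for x
  proof -
    have "(\<lambda>_. -1, 0) \<in> chains (-1)" by (simp add: chains_def)
    then show ?thesis using extend[of _ "-1" x] that by (cases "x = -1") fastforce+
  qed
  \<comment> \<open>A chain ending before 0 extends to a partition of the whole interval without
    decreasing its sum.\<close>
  have bdd: "bdd_above (S ` chains x)" if "x \<le> 0" for x
  proof (rule bdd_aboveI2)
    fix c assume c: "c \<in> chains x"
    show "S c \<le> ?v"
    proof (cases "x = 0")
      case False
      then obtain c' where "c' \<in> chains 0" "S c' = S c + matrix_norm N (D 0 - D x)"
        using extend[OF c, of 0] \<open>x \<le> 0\<close> by auto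
      then show ?thesis using S_le[of c'] matrix_norm_nonneg[OF N, of "D 0 - D x"] by simp
    qed (use c S_le in simp)
  qed
  show ?thesis
  proof
    fix x y :: real assume xy: "-1 \<le> x" "x \<le> y" "y \<le> 0"
    show "matrix_norm N (D y - D x) \<le> W y - W x"
    proof (cases "x = y")
      case False
      have "W x \<le> W y - matrix_norm N (D y - D x)"
        unfolding W_def[of x]
      proof (rule cSUP_least[OF chains_ne[OF xy(1)]])
        fix c assume "c \<in> chains x"
        then obtain c' where c': "c' \<in> chains y" "S c' = S c + matrix_norm N (D y - D x)"
          using extend[of c x y] xy False by auto
        have "S c' \<le> W y" unfolding W_def using c'(1) by (intro cSUP_upper bdd xy)
        then show "S c \<le> W y - matrix_norm N (D y - D x)" using c'(2) by simp
      qed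
      then show ?thesis by simp
    qed (simp add: matrix_norm_0[OF N])
  next
    fix x :: real assume x: "x \<in> {-1..0}"
    obtain c where "c \<in> chains x" using chains_ne[of x] x by auto
    then have "S c \<le> W x" unfolding W_def using x by (intro cSUP_upper bdd) auto
    then show "0 \<le> W x" using S0[of c] by simp
  next
    show "W 0 \<le> ?v" unfolding W_def using S_le by (intro cSUP_least chains_ne) auto
  qed
qed

text \<open>Equivalence of norms: \<open>N\<close> is convex, hence continuous, and attains a
  positive minimum on the compact Euclidean sphere. An entry of \<open>A\<close> is a component of
  the image of a basis vector, which the induced norm controls.\<close>

lemma matrix_entry_le_matrix_norm:
  fixes N :: "real ^ 'n \<Rightarrow> real"
  assumes N: "is_norm N"
  obtains K where "0 < K" "\<And>A i j. \<bar>A $ i $ j\<bar> \<le> K * matrix_norm N A"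
proof -
  have nn: "0 \<le> N x" and z: "N x = 0 \<longleftrightarrow> x = 0" and sc: "N (c *\<^sub>R x) = \<bar>c\<bar> * N x"
    and tri: "N (x + y) \<le> N x + N y" for x y c
    using N by (auto simp: is_norm_def)
  define C where "C = (\<Sum>i\<in>UNIV. N (axis i 1))"
  have C0: "0 \<le> C" unfolding C_def by (intro sum_nonneg) (simp add: nn)
  have "convex_on UNIV N"
  proof (rule convex_onI)
    fix t x y assume "0 < t" "t < (1::real)"
    then show "N ((1 - t) *\<^sub>R x + t *\<^sub>R y) \<le> (1 - t) * N x + t * N y"
      using tri[of "(1 - t) *\<^sub>R x" "t *\<^sub>R y"] by (simp add: sc)
  qed simp
  then have "continuous_on UNIV N" by (intro convex_on_continuous) auto
  then have cont: "continuous_on (sphere 0 1) N" by (rule continuous_on_subset) simp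
  obtain x0 where x0: "x0 \<in> sphere 0 1" "\<And>x. x \<in> sphere 0 1 \<Longrightarrow> N x0 \<le> N x"
    using continuous_attains_inf[OF compact_sphere _ cont]
    by (auto simp: ex_in_conv[symmetric] vector_choose_size)
  have c: "N x0 > 0" using x0(1) nn[of x0] z[of x0] by fastforce
  have low: "N x0 * norm x \<le> N x" for x
  proof (cases "x = 0")
    case False
    have "N x0 \<le> N (inverse (norm x) *\<^sub>R x)" using False by (intro x0(2)) auto
    then show ?thesis using False by (simp add: sc field_simps)
  qed (use z nn in auto)
  show ?thesis
  proof
    \<comment> \<open>The summand 1 makes the constant positive from \<open>0 \<le> C\<close>
      alone.\<close>
    show "0 < (C + 1) / N x0" using C0 c by simp
    fix A :: "real ^ 'n ^ 'n" and i j
    have Nj: "N (axis j 1) \<noteq> 0" by (simp add: z axis_eq_0_iff)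
    have "N x0 * \<bar>A $ i $ j\<bar> = N x0 * \<bar>(A *v axis j 1) $ i\<bar>"
      by (simp add: matrix_vector_mult_basis column_def)
    also have "\<dots> \<le> N x0 * norm (A *v axis j 1)"
      using c by (intro mult_left_mono component_le_norm_cart) auto
    also have "\<dots> \<le> N (A *v axis j 1)" by (rule low)
    also have "\<dots> \<le> matrix_norm N A * N (axis j 1)"
      using matrix_norm_upper[OF N, of "axis j 1" A] Nj nn[of "axis j 1"]
      by (simp add: divide_le_eq axis_eq_0_iff)
    also have "\<dots> \<le> matrix_norm N A * (C + 1)"
    proof (intro mult_left_mono matrix_norm_nonneg N)
      have "N (axis j 1) \<le> C" unfolding C_def by (rule member_le_sum) (auto simp: nn)
      then show "N (axis j 1) \<le> C + 1" by simp
    qed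
    finally show "\<bar>A $ i $ j\<bar> \<le> (C + 1) / N x0 * matrix_norm N A"
      using c by (simp add: field_simps)
  qed
qed


text \<open>A quantitative Jordan decomposition. A single increasing function dominates the
  increments of all entries, so \<open>P\<close> is shared by them. The constant \<open>K\<close> is
  independent of \<open>M\<close>, which turns the mass bound into a continuity estimate
  later.\<close>

lemma NBV_measures:
  fixes N :: "real ^ 'n \<Rightarrow> real"
  assumes N: "is_norm N"
  obtains K where "0 < K"
    "\<And>M. M \<in> NBV N \<Longrightarrow> \<exists>P Q. finite_measure_on_I P \<and> (\<forall>i j. finite_measure_on_I (Q i j)) \<and>
      (\<forall>i j. \<forall>t\<in>{-1<..0}. measure P {-1..t} - measure (Q i j) {-1..t} = M t $ i $ j) \<and>
      (\<forall>i j. measure P {-1..0} + measure (Q i j) {-1..0} \<le> K * enn2real (total_variation N M))"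
proof -
  obtain K where K: "0 < K" "\<And>(A :: real ^ 'n ^ 'n) i j. \<bar>A $ i $ j\<bar> \<le> K * matrix_norm N A"
    using matrix_entry_le_matrix_norm[OF N] by blast
  show ?thesis
  proof
    show "0 < 3 * K" using K by simp
    fix M assume M: "M \<in> NBV N"
    then have fin: "total_variation N M < \<infinity>" and M1: "M (-1) = 0"
      and cont: "\<And>t. t \<in> {-1<..<0} \<Longrightarrow> (M \<longlongrightarrow> M t) (at_right t)"
      by (auto simp: NBV_def continuous_within)
    let ?v = "enn2real (total_variation N M)"
    obtain W where W: "\<And>x y. -1 \<le> x \<Longrightarrow> x \<le> y \<Longrightarrow> y \<le> 0 \<Longrightarrow> matrix_norm N (M y - M x) \<le> W y - W x"
      "\<And>x. x \<in> {-1..0} \<Longrightarrow> 0 \<le> W x" "W 0 \<le> ?v"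
      using variation_function[OF N fin] by blast
    have entry: "\<bar>M y $ i $ j - M x $ i $ j\<bar> \<le> K * W y - K * W x"
      if "-1 \<le> x" "x \<le> y" "y \<le> 0" for x y i j
    proof -
      have "\<bar>M y $ i $ j - M x $ i $ j\<bar> \<le> K * matrix_norm N (M y - M x)"
        using K(2)[of "M y - M x" i j] by simp
      also have "\<dots> \<le> K * (W y - W x)" using K(1) W(1)[OF that] by (intro mult_left_mono) auto
      finally show ?thesis by (simp add: algebra_simps)
    qed
    have W_mono: "W x \<le> W y" if "-1 \<le> x" "x \<le> y" "y \<le> 0" for x y
      using W(1)[OF that] matrix_norm_nonneg[OF N, of "M y - M x"] by simp
    txt \<open>\<open>K * W\<close> and \<open>K * W - g\<close> are both increasing, and the right continuity of \<open>M\<close> recovers \<open>g\<close> as the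
      difference of their right limits; so \<open>W\<close> itself need not be right continuous.\<close>
    define U where "U g t = (if t < -1 then 0 else K * W (min t 0) - g (min t 0))"
      for g :: "real \<Rightarrow> real" and t
    have U: "\<exists>P. finite_measure_on_I P \<and> (\<forall>t\<in>{-1<..0}. (U g \<longlongrightarrow> measure P {-1..t}) (at_right t))"
      if g: "\<And>x y. -1 \<le> x \<Longrightarrow> x \<le> y \<Longrightarrow> y \<le> 0 \<Longrightarrow> \<bar>g y - g x\<bar> \<le> K * W y - K * W x" and g1: "g (-1) = 0" for g
    proof -
      have pos: "0 \<le> U g y" if "-1 \<le> y" for y
        using that g[of "-1" "min y 0"] g1 W(2)[of "-1"] K(1) by (simp add: U_def) (smt (verit) mult_nonneg_nonneg)
      have "mono (U g)"
      proof (rule monoI)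
        fix x y :: real assume xy: "x \<le> y"
        show "U g x \<le> U g y"
        proof (cases "x < -1")
          case True
          then have "U g x = 0" by (simp add: U_def)
          moreover have "0 \<le> U g y" using pos[of y] by (cases "y < -1") (auto simp: U_def)
          ultimately show ?thesis by simp
        next
          case False
          then show ?thesis using g[of "min x 0" "min y 0"] xy by (simp add: U_def) linarith
        qed
      qed
      then show ?thesis by (rule Stieltjes_measure_on_I[of "U g"]) (auto simp: U_def)
    qed
    \<comment> \<open>At 0 membership in \<open>NBV\<close> gives no right continuity. Instead
      \<open>U g\<close> is constant to the right of 0 by its definition, so its right limit there
      is \<open>U g 0\<close>.\<close>
    have atR: "measure P {-1..0} = U g 0" if "(U g \<longlongrightarrow> measure P {-1..0}) (at_right 0)" for g P
    proof (rule tendsto_unique[OF _ that])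
      show "(U g \<longlongrightarrow> U g 0) (at_right 0)"
        by (rule tendsto_eventually) (auto simp: eventually_at_filter U_def)
    qed simp
    have "\<exists>P. finite_measure_on_I P \<and> (\<forall>t\<in>{-1<..0}. (U (\<lambda>_. 0) \<longlongrightarrow> measure P {-1..t}) (at_right t))"
      using W_mono K(1) by (intro U) simp_all
    then obtain P where P: "finite_measure_on_I P"
      "\<And>t. t \<in> {-1<..0} \<Longrightarrow> (U (\<lambda>_. 0) \<longlongrightarrow> measure P {-1..t}) (at_right t)"
      by blast
    have "\<forall>i j. \<exists>Q. finite_measure_on_I Q \<and>
        (\<forall>t\<in>{-1<..0}. (U (\<lambda>t. M t $ i $ j) \<longlongrightarrow> measure Q {-1..t}) (at_right t))"
      using entry M1 by (intro allI U) auto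
    then obtain Q where Q: "\<And>i j. finite_measure_on_I (Q i j)"
      "\<And>i j t. t \<in> {-1<..0} \<Longrightarrow> (U (\<lambda>t. M t $ i $ j) \<longlongrightarrow> measure (Q i j) {-1..t}) (at_right t)"
      by metis
    have "measure P {-1..t} - measure (Q i j) {-1..t} = M t $ i $ j" if t: "t \<in> {-1<..0}" for i j t
    proof (cases "t = 0")
      case True
      then show ?thesis using atR[OF P(2)[of 0]] atR[OF Q(2)[of 0 i j]] by (simp add: U_def)
    next
      case False
      let ?d = "\<lambda>s. U (\<lambda>_. 0) s - U (\<lambda>t. M t $ i $ j) s"
      have "(?d \<longlongrightarrow> measure P {-1..t} - measure (Q i j) {-1..t}) (at_right t)"
        using P(2)[OF t] Q(2)[OF t] by (rule tendsto_diff)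
      moreover have "(?d \<longlongrightarrow> M t $ i $ j) (at_right t)"
      proof (rule Lim_transform_eventually)
        show "((\<lambda>s. M s $ i $ j) \<longlongrightarrow> M t $ i $ j) (at_right t)"
          using t False by (intro tendsto_vec_nth cont) auto
        have "\<forall>s>t. s < 0 \<longrightarrow> M s $ i $ j = ?d s" using t by (auto simp: U_def)
        then show "\<forall>\<^sub>F s in at_right t. M s $ i $ j = ?d s"
          using t False unfolding eventually_at_right_field by (intro exI[of _ 0]) auto
      qed
      ultimately show ?thesis by (rule tendsto_unique[rotated]) simp
    qed
    \<comment> \<open>The masses are \<open>K * W 0\<close> and
      \<open>K * W 0 - M 0 $ i $ j\<close>. The latter is at most \<open>2 * K * W 0\<close>, which
      explains the factor 3.\<close>
    moreover have "measure P {-1..0} + measure (Q i j) {-1..0} \<le> 3 * K * ?v" for i j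
    proof -
      have "K * W 0 \<le> K * ?v" using W(3) K(1) by (intro mult_left_mono) auto
      moreover have "\<bar>M 0 $ i $ j\<bar> \<le> K * W 0"
      proof -
        have "0 \<le> K * W (-1)" using W(2)[of "-1"] K(1) by simp
        then show ?thesis using entry[of "-1" 0 i j] M1 by simp
      qed
      moreover have "measure P {-1..0} = K * W 0" "measure (Q i j) {-1..0} = K * W 0 - M 0 $ i $ j"
        using atR[OF P(2)[of 0]] atR[OF Q(2)[of 0 i j]] by (simp_all add: U_def)
      ultimately show ?thesis by linarith
    qed
    ultimately show "\<exists>P Q. finite_measure_on_I P \<and> (\<forall>i j. finite_measure_on_I (Q i j)) \<and>
      (\<forall>i j. \<forall>t\<in>{-1<..0}. measure P {-1..t} - measure (Q i j) {-1..t} = M t $ i $ j) \<and>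
      (\<forall>i j. measure P {-1..0} + measure (Q i j) {-1..0} \<le> 3 * K * ?v)"
      using P(1) Q(1) by blast
  qed
qed

section \<open>Identification and bounds of the integral against \<open>dM\<close>\<close>

text \<open>This discharges the definite description: two candidates agree on the generating
  intervals, hence on Borel sets, and both are zero elsewhere by convention.\<close>

lemma measure_of_NBV_eqI:
  fixes M :: "real \<Rightarrow> real ^ 'n ^ 'n"
  assumes \<mu>: "matrix_measure \<mu>" and M: "\<And>t. t \<in> {-1<..0} \<Longrightarrow> \<mu> {-1..t} = M t"
  shows "measure_of_NBV M = \<mu>"
  unfolding measure_of_NBV_def
proof (rule the_equality)
  show "matrix_measure \<mu> \<and> (\<forall>t\<in>{-1<..0}. \<mu> {-1..t} = M t)" using \<mu> M by blast
  fix \<mu>' assume \<mu>': "matrix_measure \<mu>' \<and> (\<forall>t\<in>{-1<..0}. \<mu>' {-1..t} = M t)"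
  show "\<mu>' = \<mu>"
  proof
    fix E show "\<mu>' E = \<mu> E"
    proof (cases "E \<in> sets borel_I")
      case True
      have "\<mu>' E - \<mu> E = 0"
        by (rule countably_additive_eq_0[where \<nu> = "\<lambda>E. \<mu>' E - \<mu> E", OF _ _ True])
          (use \<mu> \<mu>' M in \<open>auto simp: matrix_measure_def intro!: sums_diff\<close>)
      then show ?thesis by simp
    qed (use \<mu> \<mu>' in \<open>auto simp: matrix_measure_def\<close>)
  qed
qed

text \<open>The entrywise differences \<open>P - Q i j\<close> form a matrix measure with the
  prescribed values on intervals, so by uniqueness it is the measure of \<open>M\<close>. This
  reduces \<open>matrix_integral\<close> to ordinary integrals.\<close>

lemma matrix_integral_eq:
  fixes M :: "real \<Rightarrow> real ^ 'n ^ 'n"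
  assumes P: "finite_measure_on_I P" and Q: "\<And>i j. finite_measure_on_I (Q i j)"
    and M: "\<And>i j t. t \<in> {-1<..0} \<Longrightarrow> measure P {-1..t} - measure (Q i j) {-1..t} = M t $ i $ j"
    and f: "f \<in> borel_measurable borel_I" and B: "\<And>x. x \<in> {-1..0} \<Longrightarrow> cmod (f x) \<le> B"
  shows "matrix_integral f M $ i $ j = integral\<^sup>L P f - integral\<^sup>L (Q i j) f"
proof -
  define \<mu> :: "real set \<Rightarrow> real ^ 'n ^ 'n"
    where "\<mu> E = (if E \<in> sets borel_I then (\<chi> i j. measure P E - measure (Q i j) E) else 0)" for E
  have "matrix_measure \<mu>"
    unfolding matrix_measure_def
  proof (intro conjI allI impI)
    fix A :: "nat \<Rightarrow> real set"
    assume A: "range A \<subseteq> sets borel_I \<and> disjoint_family A"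
    have "(\<Union>i. A i) \<in> sets borel_I" using A by (intro sets.countable_UN) auto
    moreover have "(\<lambda>k. measure P (A k) - measure (Q i j) (A k)) sums
        (measure P (\<Union>i. A i) - measure (Q i j) (\<Union>i. A i))" for i j
      using A finite_measure_on_I_D[OF P] finite_measure_on_I_D[OF Q[of i j]]
      by (intro sums_diff finite_measure.finite_measure_UNION) auto
    ultimately show "(\<lambda>i. \<mu> (A i)) sums \<mu> (\<Union>i. A i)"
      using A unfolding sums_def by (intro vec_tendstoI) (auto simp: \<mu>_def image_subset_iff)
  qed (simp add: \<mu>_def)
  moreover have "\<mu> {-1..t} = M t" if t: "t \<in> {-1<..0}" for t
  proof -
    have "{-1..t} \<in> sets borel_I" using t by (auto simp: sets_borel_I_iff)
    then show ?thesis using M[OF t] by (simp add: \<mu>_def vec_eq_iff)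
  qed
  ultimately have \<mu>: "measure_of_NBV M = \<mu>" by (rule measure_of_NBV_eqI)
  have "signed_integral (\<lambda>E. measure_of_NBV M E $ i $ j) f = integral\<^sup>L P f - integral\<^sup>L (Q i j) f"
    unfolding \<mu> by (rule signed_integral_diff[OF P Q _ f B]) (auto simp: \<mu>_def)
  then show ?thesis by (simp add: matrix_integral_def)
qed

lemma integral_bound_on_I:
  fixes f :: "real \<Rightarrow> complex"
  assumes P: "finite_measure_on_I P" and B: "\<And>x. x \<in> {-1..0} \<Longrightarrow> cmod (f x) \<le> B"
  shows "cmod (integral\<^sup>L P f) \<le> B * measure P {-1..0}"
proof -
  note D = finite_measure_on_I_D[OF P]
  interpret finite_measure P by (rule D)
  have B0: "0 \<le> B" using B[of 0] order_trans[OF norm_ge_zero] by auto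
  have "cmod (integral\<^sup>L P f) \<le> (\<integral>x. B \<partial>P)"
  proof (cases "integrable P f")
    case True
    show ?thesis
      by (rule Bochner_Integration.integral_norm_bound_integral[OF True]) (use B in \<open>auto simp: D\<close>)
  next
    \<comment> \<open>The integral of a nonintegrable function is 0 by convention, and the
      right-hand side is nonnegative.\<close>
    case False
    then show ?thesis using B0 by (simp add: not_integrable_integral_eq)
  qed
  then show ?thesis by (simp add: D mult.commute)
qed

lemma NBV_diff:
  assumes N: "is_norm N" and M: "M \<in> NBV N" and M': "M' \<in> NBV N"
  shows "(\<lambda>t. M t - M' t) \<in> NBV N"
proof -
  have "total_variation N (\<lambda>t. M t - M' t) \<le> total_variation N M + total_variation N M'"
    using total_variation_triangle[OF N, of M "\<lambda>t. - M' t"] total_variation_minus[OF N, of M'] by simp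
  also have "\<dots> < \<infinity>" using M M' by (simp add: NBV_def)
  finally show ?thesis using M M' by (auto simp: NBV_def intro!: continuous_intros)
qed

text \<open>The second estimate is the first one for \<open>M - M'\<close>, once the integral is
  known to be additive in \<open>M\<close>. As \<open>M\<close>, \<open>M'\<close> and
  \<open>M - M'\<close> each come with their own pair of measures, this additivity is checked on
  intervals.\<close>

lemma matrix_integral_bound:
  fixes N :: "real ^ 'n \<Rightarrow> real"
  assumes N: "is_norm N"
  obtains K where "0 < K"
    "\<And>M f B i j. M \<in> NBV N \<Longrightarrow> f \<in> borel_measurable borel_I \<Longrightarrow> (\<And>x. x \<in> {-1..0} \<Longrightarrow> cmod (f x) \<le> B) \<Longrightarrow>
      cmod (matrix_integral f M $ i $ j) \<le> B * (K * enn2real (total_variation N M))"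
    "\<And>M M' f B i j. M \<in> NBV N \<Longrightarrow> M' \<in> NBV N \<Longrightarrow> f \<in> borel_measurable borel_I \<Longrightarrow>
      (\<And>x. x \<in> {-1..0} \<Longrightarrow> cmod (f x) \<le> B) \<Longrightarrow>
      cmod (matrix_integral f M $ i $ j - matrix_integral f M' $ i $ j) \<le> B * (K * var_dist N M M')"
proof -
  obtain K where K: "0 < K"
    "\<And>M. M \<in> NBV N \<Longrightarrow> \<exists>P Q. finite_measure_on_I P \<and> (\<forall>i j. finite_measure_on_I (Q i j)) \<and>
      (\<forall>i j. \<forall>t\<in>{-1<..0}. measure P {-1..t} - measure (Q i j) {-1..t} = M t $ i $ j) \<and>
      (\<forall>i j. measure P {-1..0} + measure (Q i j) {-1..0} \<le> K * enn2real (total_variation N M))"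
    using NBV_measures[OF N] by blast
  have bound: "cmod (matrix_integral f M $ i $ j) \<le> B * (K * enn2real (total_variation N M))"
    if M: "M \<in> NBV N" and f: "f \<in> borel_measurable borel_I" and B: "\<And>x. x \<in> {-1..0} \<Longrightarrow> cmod (f x) \<le> B"
    for M f B i j
  proof -
    obtain P Q where P: "finite_measure_on_I P" and Q: "\<And>i j. finite_measure_on_I (Q i j)"
      and PQ: "\<And>i j t. t \<in> {-1<..0} \<Longrightarrow> measure P {-1..t} - measure (Q i j) {-1..t} = M t $ i $ j"
      and le: "\<And>i j. measure P {-1..0} + measure (Q i j) {-1..0} \<le> K * enn2real (total_variation N M)"
      using K(2)[OF M] by blast
    have "0 \<le> B" using B[of 0] order_trans[OF norm_ge_zero] by auto
    have "cmod (matrix_integral f M $ i $ j) = cmod (integral\<^sup>L P f - integral\<^sup>L (Q i j) f)"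
      using matrix_integral_eq[OF P Q PQ f B] by simp
    also have "\<dots> \<le> cmod (integral\<^sup>L P f) + cmod (integral\<^sup>L (Q i j) f)" by (rule norm_triangle_ineq4)
    also have "\<dots> \<le> B * measure P {-1..0} + B * measure (Q i j) {-1..0}"
      by (intro add_mono integral_bound_on_I P Q B)
    also have "\<dots> = B * (measure P {-1..0} + measure (Q i j) {-1..0})" by (simp add: distrib_left)
    also have "\<dots> \<le> B * (K * enn2real (total_variation N M))"
      using le \<open>0 \<le> B\<close> by (intro mult_left_mono) auto
    finally show ?thesis .
  qed
  have diff: "matrix_integral f M $ i $ j - matrix_integral f M' $ i $ j
      = matrix_integral f (\<lambda>t. M t - M' t) $ i $ j"
    if M: "M \<in> NBV N" and M': "M' \<in> NBV N" and f: "f \<in> borel_measurable borel_I"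
      and B: "\<And>x. x \<in> {-1..0} \<Longrightarrow> cmod (f x) \<le> B" for M M' f B i j
  proof -
    obtain P Q where P: "finite_measure_on_I P" and Q: "\<And>i j. finite_measure_on_I (Q i j)"
      and PQ: "\<And>i j t. t \<in> {-1<..0} \<Longrightarrow> measure P {-1..t} - measure (Q i j) {-1..t} = M t $ i $ j"
      using K(2)[OF M] by blast
    obtain P' Q' where P': "finite_measure_on_I P'" and Q': "\<And>i j. finite_measure_on_I (Q' i j)"
      and PQ': "\<And>i j t. t \<in> {-1<..0} \<Longrightarrow> measure P' {-1..t} - measure (Q' i j) {-1..t} = M' t $ i $ j"
      using K(2)[OF M'] by blast
    obtain R S where R: "finite_measure_on_I R" and S: "\<And>i j. finite_measure_on_I (S i j)"
      and RS: "\<And>i j t. t \<in> {-1<..0} \<Longrightarrow> measure R {-1..t} - measure (S i j) {-1..t} = (M t - M' t) $ i $ j"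
      using K(2)[OF NBV_diff[OF N M M']] by blast
    \<comment> \<open>The list encodes \<open>(P - Q i j) - (P' - Q' i j) - (R - S i j)\<close>,
      whose value on \<open>{-1..t}\<close> is zero.\<close>
    have "(\<Sum>x\<leftarrow>[(1,P), (-1,Q i j), (-1,P'), (1,Q' i j), (-1,R), (1,S i j)].
        fst x *\<^sub>R integral\<^sup>L (snd x) f) = 0"
    proof (rule lincomb_integral_eq_0[OF _ _ f B])
      fix t :: real assume t: "t \<in> {-1<..0}"
      then show "(\<Sum>x\<leftarrow>[(1,P), (-1,Q i j), (-1,P'), (1,Q' i j), (-1,R), (1,S i j)].
          fst x * measure (snd x) {-1..t}) = 0"
        using PQ[OF t, of i j] PQ'[OF t, of i j] RS[OF t, of i j] by simp
    qed (use P Q P' Q' R S in auto)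
    then have "integral\<^sup>L P f - integral\<^sup>L (Q i j) f - (integral\<^sup>L P' f - integral\<^sup>L (Q' i j) f)
        = integral\<^sup>L R f - integral\<^sup>L (S i j) f"
      by (simp add: algebra_simps)
    moreover have "matrix_integral f M $ i $ j = integral\<^sup>L P f - integral\<^sup>L (Q i j) f"
      by (rule matrix_integral_eq[OF P Q PQ f B])
    moreover have "matrix_integral f M' $ i $ j = integral\<^sup>L P' f - integral\<^sup>L (Q' i j) f"
      by (rule matrix_integral_eq[OF P' Q' PQ' f B])
    moreover have "matrix_integral f (\<lambda>t. M t - M' t) $ i $ j = integral\<^sup>L R f - integral\<^sup>L (S i j) f"
      by (rule matrix_integral_eq[OF R S RS f B])
    ultimately show ?thesis by simp
  qed
  show ?thesis
  proof
    show "0 < K" by (rule K)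
    fix M f B i j
    assume "M \<in> NBV N" "f \<in> borel_measurable borel_I" "\<And>x. x \<in> {-1..0} \<Longrightarrow> cmod (f x) \<le> B"
    then show "cmod (matrix_integral f M $ i $ j) \<le> B * (K * enn2real (total_variation N M))"
      by (rule bound)
  next
    fix M M' f B i j
    assume A: "M \<in> NBV N" "M' \<in> NBV N" "f \<in> borel_measurable borel_I"
      and B: "\<And>x. x \<in> {-1..0} \<Longrightarrow> cmod (f x) \<le> B"
    show "cmod (matrix_integral f M $ i $ j - matrix_integral f M' $ i $ j) \<le> B * (K * var_dist N M M')"
      using bound[OF NBV_diff[OF N A(1,2)] A(3) B] diff[OF A B] by (simp add: var_dist_def)
  qed
qed

section \<open>The characteristic function\<close>

lemma exp_kernel_measurable: "(\<lambda>\<theta>. exp (s * of_real \<theta>) :: complex) \<in> borel_measurable borel_I"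
  by (intro measurable_restrict_space1 borel_measurable_continuous_onI continuous_intros)

lemma exp_kernel_bound:
  assumes "\<alpha> \<le> Re s" "\<theta> \<in> {-1..0}"
  shows "cmod (exp (s * of_real \<theta>)) \<le> exp \<bar>\<alpha>\<bar>"
proof -
  have "Re s * \<theta> \<le> \<alpha> * \<theta>" using assms by (intro mult_right_mono_neg) auto
  also have "\<dots> \<le> \<bar>\<alpha> * \<theta>\<bar>" by (rule abs_ge_self)
  also have "\<dots> \<le> \<bar>\<alpha>\<bar> * 1" unfolding abs_mult using assms by (intro mult_left_mono) auto
  finally show ?thesis by (simp add: norm_exp_eq_Re)
qed

lemma continuous_on_det:
  fixes A :: "'a::topological_space \<Rightarrow> complex ^ 'n ^ 'n"
  assumes "\<And>i j. continuous_on S (\<lambda>x. A x $ i $ j)"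
  shows "continuous_on S (\<lambda>x. det (A x))"
  unfolding det_def by (intro continuous_intros assms)

lemma norm_matrix_le_entries:
  fixes A :: "complex ^ 'n ^ 'n"
  assumes "\<And>i j. cmod (A $ i $ j) \<le> b"
  shows "norm A \<le> real (CARD('n)) * (real (CARD('n)) * b)"
proof -
  have "norm (A $ i) \<le> real (CARD('n)) * b" for i
  proof -
    have "norm (A $ i) \<le> (\<Sum>j\<in>UNIV. cmod (A $ i $ j))"
      unfolding norm_vec_def by (rule L2_set_le_sum) simp
    also have "\<dots> \<le> (\<Sum>j\<in>(UNIV::'n set). b)" by (intro sum_mono assms)
    finally show ?thesis by simp
  qed
  then have "(\<Sum>i\<in>UNIV. norm (A $ i)) \<le> (\<Sum>i\<in>(UNIV::'n set). real (CARD('n)) * b)"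
    by (intro sum_mono)
  moreover have "norm A \<le> (\<Sum>i\<in>UNIV. norm (A $ i))"
    unfolding norm_vec_def[of A] by (rule L2_set_le_sum) simp
  ultimately show ?thesis by simp
qed

text \<open>One \<open>\<delta>\<close> serves the whole half plane because the matrices for
  \<open>M\<close> and \<open>M'\<close> stay in a single compact ball for all such
  \<open>s\<close>, and \<open>det\<close> is uniformly continuous on it.\<close>

lemma char_fun_uniformly_close:
  fixes N :: "real ^ 'n \<Rightarrow> real"
  assumes N: "is_norm N" and M: "M \<in> NBV N" and e: "0 < e"
  obtains \<delta> where "0 < \<delta>"
    "\<And>M' s. M' \<in> NBV N \<Longrightarrow> var_dist N M M' < \<delta> \<Longrightarrow> \<alpha> \<le> Re s \<Longrightarrow> cmod (char_fun M s - char_fun M' s) < e"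
proof -
  define I :: "complex \<Rightarrow> (real \<Rightarrow> real ^ 'n ^ 'n) \<Rightarrow> complex ^ 'n ^ 'n"
    where "I s = matrix_integral (\<lambda>\<theta>. exp (s * of_real \<theta>))" for s
  define n where "n = real (CARD('n))"
  have n: "0 < n" by (simp add: n_def)
  obtain K where K: "0 < K"
    "\<And>M s i j. M \<in> NBV N \<Longrightarrow> \<alpha> \<le> Re s \<Longrightarrow> cmod (I s M $ i $ j) \<le> exp \<bar>\<alpha>\<bar> * (K * enn2real (total_variation N M))"
    "\<And>M M' s i j. M \<in> NBV N \<Longrightarrow> M' \<in> NBV N \<Longrightarrow> \<alpha> \<le> Re s \<Longrightarrow>
      cmod (I s M $ i $ j - I s M' $ i $ j) \<le> exp \<bar>\<alpha>\<bar> * (K * var_dist N M M')"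
    using matrix_integral_bound[OF N] exp_kernel_measurable exp_kernel_bound unfolding I_def by metis
  \<comment> \<open>An entry bound for both matrices: the first 1 is for the identity, the middle
    term for the integral against \<open>M\<close>, and the last 1 for the perturbation by at most
    \<open>\<eta> \<le> 1\<close>.\<close>
  define b where "b = 1 + exp \<bar>\<alpha>\<bar> * (K * enn2real (total_variation N M)) + 1"
  define C where "C = cball (0 :: complex ^ 'n ^ 'n) (n * (n * b))"
  have "uniformly_continuous_on C (det :: complex ^ 'n ^ 'n \<Rightarrow> complex)"
    unfolding C_def by (intro compact_uniformly_continuous continuous_on_det continuous_intros) auto
  then obtain d where d: "0 < d"
    "\<And>A B. A \<in> C \<Longrightarrow> B \<in> C \<Longrightarrow> dist A B < d \<Longrightarrow> dist (det A) (det B :: complex) < e"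
    using e unfolding uniformly_continuous_on_def by metis
  \<comment> \<open>Passing from entries to the matrix norm costs a factor \<open>n * n\<close>; the
    2 makes the final comparison with \<open>d\<close> strict.\<close>
  define \<eta> where "\<eta> = min 1 (d / (2 * n * n))"
  define \<delta> where "\<delta> = \<eta> / (exp \<bar>\<alpha>\<bar> * K)"
  have \<eta>: "0 < \<eta>" using d n by (simp add: \<eta>_def)
  show ?thesis
  proof
    show "0 < \<delta>" using \<eta> K(1) by (simp add: \<delta>_def)
    fix M' s assume M': "M' \<in> NBV N" and lt: "var_dist N M M' < \<delta>" and s: "\<alpha> \<le> Re s"
    have close: "cmod (I s M $ i $ j - I s M' $ i $ j) \<le> \<eta>" for i j
    proof -
      have "exp \<bar>\<alpha>\<bar> * (K * var_dist N M M') \<le> \<eta>"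
        using lt K(1) by (simp add: \<delta>_def field_simps)
      then show ?thesis using K(3)[OF M M' s, of i j] by linarith
    qed
    let ?A = "mat 1 - I s M" and ?B = "mat 1 - I s M'"
    have mat1: "cmod ((mat 1 :: complex ^ 'n ^ 'n) $ i $ j) \<le> 1" for i j by (simp add: mat_def)
    have "cmod (?A $ i $ j) \<le> b" for i j
    proof -
      have "cmod (?A $ i $ j) \<le> cmod ((mat 1 :: complex ^ 'n ^ 'n) $ i $ j) + cmod (I s M $ i $ j)"
        by (simp add: norm_triangle_ineq4)
      then show ?thesis using mat1[of i j] K(2)[OF M s, of i j] by (simp add: b_def)
    qed
    then have A: "?A \<in> C" using norm_matrix_le_entries[of ?A b] by (simp add: C_def n_def)
    have "cmod (?B $ i $ j) \<le> b" for i j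
    proof -
      have "cmod (?B $ i $ j) \<le> cmod ((mat 1 :: complex ^ 'n ^ 'n) $ i $ j) + cmod (I s M' $ i $ j)"
        by (simp add: norm_triangle_ineq4)
      moreover have "cmod (I s M' $ i $ j) \<le> cmod (I s M $ i $ j) + cmod (I s M $ i $ j - I s M' $ i $ j)"
        by (metis norm_minus_commute norm_triangle_sub)
      moreover have "\<eta> \<le> 1" by (simp add: \<eta>_def)
      ultimately show ?thesis
        using mat1[of i j] K(2)[OF M s, of i j] close[of i j] unfolding b_def by linarith
    qed
    then have B: "?B \<in> C" using norm_matrix_le_entries[of ?B b] by (simp add: C_def n_def)
    have "dist ?A ?B = norm (?A - ?B)" by (rule dist_norm)
    also have "\<dots> \<le> n * (n * \<eta>)"
      unfolding n_def using close by (intro norm_matrix_le_entries) (simp add: norm_minus_commute)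
    also have "\<dots> \<le> n * (n * (d / (2 * n * n)))"
      using n by (intro mult_left_mono) (auto simp: \<eta>_def)
    also have "\<dots> < d" using n d(1) by simp
    finally have "dist (det ?A) (det ?B) < e" by (rule d(2)[OF A B])
    then show "cmod (char_fun M s - char_fun M' s) < e"
      by (simp add: char_fun_def I_def dist_norm)
  qed
qed

section \<open>Analyticity of the characteristic function\<close>

text \<open>Integrating the exponential series termwise gives an everywhere convergent power series
  in \<open>s\<close> whose coefficients are moments of \<open>P\<close>. The exchange is allowed
  because \<open>\<bar>\<theta>\<bar> \<le> 1\<close> bounds the terms by those of the series of
  \<open>exp (norm s)\<close>.\<close>

lemma holomorphic_exp_integral:
  assumes P: "finite_measure_on_I P"
  shows "(\<lambda>s. \<integral>\<theta>. exp (s * of_real \<theta>) \<partial>P) holomorphic_on UNIV"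
proof -
  note D = finite_measure_on_I_D[OF P]
  interpret finite_measure P by (rule D)
  let ?a = "\<lambda>n. \<integral>\<theta>. (of_real \<theta> ^ n /\<^sub>R fact n :: complex) \<partial>P"
  have series: "(\<lambda>n. ?a n * (s - 0) ^ n) sums (\<integral>\<theta>. exp (s * of_real \<theta>) \<partial>P)" for s
  proof -
    let ?f = "\<lambda>n \<theta>. (s * of_real \<theta>) ^ n /\<^sub>R fact n :: complex"
    have meas: "(\<lambda>\<theta>. of_real \<theta> ^ n /\<^sub>R fact n :: complex) \<in> borel_measurable P"
      "?f n \<in> borel_measurable P" for n
      unfolding measurable_cong_sets[OF D(2) refl]
      by (intro measurable_restrict_space1 borel_measurable_continuous_onI continuous_intros)+
    have le: "norm (?f n \<theta>) \<le> norm s ^ n /\<^sub>R fact n" if "\<theta> \<in> {-1..0}" for n \<theta>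
    proof -
      have "cmod (s * of_real \<theta>) \<le> cmod s * 1"
        unfolding norm_mult using that by (intro mult_left_mono) auto
      then have "cmod (s * of_real \<theta>) ^ n \<le> cmod s ^ n" by (intro power_mono) auto
      then show ?thesis
        by (simp only: norm_scaleR norm_power) (simp add: mult_left_mono)
    qed
    have int: "integrable P (?f n)" for n
      using le meas by (intro integrable_const_bound[where B = "norm s ^ n /\<^sub>R fact n"]) (auto simp: D)
    have "(\<lambda>n. integral\<^sup>L P (?f n)) sums (\<integral>\<theta>. (\<Sum>n. ?f n \<theta>) \<partial>P)"
    proof (rule sums_integral[OF int])
      show "AE \<theta> in P. summable (\<lambda>n. norm (?f n \<theta>))" by (intro AE_I2 summable_norm_exp)
      show "summable (\<lambda>n. \<integral>\<theta>. norm (?f n \<theta>) \<partial>P)"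
      proof (rule summable_comparison_test)
        show "summable (\<lambda>n. norm s ^ n /\<^sub>R fact n * measure P (space P))"
          by (intro summable_mult2 summable_exp_generic)
        have "(\<integral>\<theta>. norm (?f n \<theta>) \<partial>P) \<le> (\<integral>\<theta>. norm s ^ n /\<^sub>R fact n \<partial>P)" for n
          using le int by (intro integral_mono integrable_norm) (auto simp: D)
        then show "\<exists>N. \<forall>n\<ge>N. norm (\<integral>\<theta>. norm (?f n \<theta>) \<partial>P) \<le> norm s ^ n /\<^sub>R fact n * measure P (space P)"
          by (simp add: mult.commute)
      qed
    qed
    also have "(\<lambda>\<theta>. \<Sum>n. ?f n \<theta>) = (\<lambda>\<theta>. exp (s * of_real \<theta>))" by (simp add: exp_def)
    also have "(\<lambda>n. integral\<^sup>L P (?f n)) = (\<lambda>n. ?a n * (s - 0) ^ n)"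
    proof
      fix n
      have "?f n = (\<lambda>\<theta>. of_real \<theta> ^ n /\<^sub>R fact n * (s - 0) ^ n)"
        by (auto simp: power_mult_distrib mult.commute)
      then show "integral\<^sup>L P (?f n) = ?a n * (s - 0) ^ n" by simp
    qed
    finally show ?thesis .
  qed
  show ?thesis
    unfolding holomorphic_on_def
  proof
    fix z :: complex
    have "(\<lambda>s. \<integral>\<theta>. exp (s * of_real \<theta>) \<partial>P) holomorphic_on ball 0 (norm z + 1)"
      by (rule power_series_holomorphic) (rule series)
    then show "(\<lambda>s. \<integral>\<theta>. exp (s * of_real \<theta>) \<partial>P) field_differentiable at z within UNIV"
      by (rule holomorphic_on_imp_differentiable_at) auto
  qed
qed

text \<open>By the Leibniz formula the determinant is a finite sum of products of entries, each an
  entire function of \<open>s\<close>.\<close>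

lemma holomorphic_char_fun:
  fixes N :: "real ^ 'n \<Rightarrow> real"
  assumes N: "is_norm N" and M: "M \<in> NBV N"
  shows "char_fun M holomorphic_on UNIV"
proof -
  obtain P Q where P: "finite_measure_on_I P" and Q: "\<And>i j. finite_measure_on_I (Q i j)"
    and PQ: "\<And>i j t. t \<in> {-1<..0} \<Longrightarrow> measure P {-1..t} - measure (Q i j) {-1..t} = M t $ i $ j"
    using NBV_measures[OF N] M by metis
  have "(mat 1 - matrix_integral (\<lambda>\<theta>. exp (s * of_real \<theta>)) M) $ i $ j
      = mat 1 $ i $ j - ((\<integral>\<theta>. exp (s * of_real \<theta>) \<partial>P) - (\<integral>\<theta>. exp (s * of_real \<theta>) \<partial>Q i j))" for s i j
    using matrix_integral_eq[OF P Q PQ exp_kernel_measurable exp_kernel_bound[OF order_refl]] by simp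
  then have "char_fun M = (\<lambda>s. \<Sum>p | p permutes (UNIV :: 'n set). of_int (sign p) * (\<Prod>i\<in>UNIV.
      mat 1 $ i $ p i - ((\<integral>\<theta>. exp (s * of_real \<theta>) \<partial>P) - (\<integral>\<theta>. exp (s * of_real \<theta>) \<partial>Q i (p i)))))"
    unfolding char_fun_def det_def by (intro ext) (simp only:)
  then show ?thesis
    by (simp only:) (intro holomorphic_intros holomorphic_exp_integral P Q)
qed

section \<open>Semicontinuity of the spectral abscissa\<close>

lemma zero_le_spectral_abscissa: "char_fun M s = 0 \<Longrightarrow> ereal (Re s) \<le> spectral_abscissa M"
  unfolding spectral_abscissa_def by (intro Sup_upper) auto

lemma spectral_abscissa_upper:
  fixes N :: "real ^ 'n \<Rightarrow> real"
  assumes N: "is_norm N" and M: "M \<in> stable_class N" and u: "spectral_abscissa M < u"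
  obtains \<delta> where "0 < \<delta>"
    "\<And>M'. M' \<in> NBV N \<Longrightarrow> var_dist N M M' < \<delta> \<Longrightarrow> spectral_abscissa M' < u"
proof -
  \<comment> \<open>The real \<open>\<alpha>\<close> lies above \<open>spectral_abscissa M\<close>
    to obtain the lower bound from \<open>stable_class\<close>, and strictly below \<open>u\<close>
    because excluding zeros only yields \<open>\<le> \<alpha>\<close>.\<close>
  obtain \<alpha> where \<alpha>: "spectral_abscissa M < ereal \<alpha>" "ereal \<alpha> < u" using ereal_dense2[OF u] by blast
  define c where "c = (INF s\<in>{s. \<alpha> \<le> Re s}. cmod (char_fun M s))"
  have M': "M \<in> NBV N" and c: "0 < c" using M \<alpha>(1) by (auto simp: stable_class_def c_def)
  have c_le: "c \<le> cmod (char_fun M s)" if "\<alpha> \<le> Re s" for s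
    unfolding c_def using that by (intro cINF_lower bdd_belowI2[of _ 0]) auto
  obtain \<delta> where \<delta>: "0 < \<delta>"
    "\<And>M' s. M' \<in> NBV N \<Longrightarrow> var_dist N M M' < \<delta> \<Longrightarrow> \<alpha> \<le> Re s \<Longrightarrow> cmod (char_fun M s - char_fun M' s) < c"
    using char_fun_uniformly_close[OF N M' c] by blast
  show ?thesis
  proof (rule that[OF \<delta>(1)])
    fix M' assume M': "M' \<in> NBV N" "var_dist N M M' < \<delta>"
    have "Re s \<le> \<alpha>" if "char_fun M' s = 0" for s
    proof (rule ccontr)
      assume "\<not> Re s \<le> \<alpha>"
      then show False using \<delta>(2)[OF M', of s] c_le[of s] that by simp
    qed
    then have "spectral_abscissa M' \<le> ereal \<alpha>"
      unfolding spectral_abscissa_def by (intro Sup_least) auto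
    then show "spectral_abscissa M' < u" using \<alpha>(2) by simp
  qed
qed

lemma spectral_abscissa_lower:
  fixes N :: "real ^ 'n \<Rightarrow> real"
  assumes N: "is_norm N" and M: "M \<in> stable_class N" and l: "l < spectral_abscissa M"
  obtains \<delta> where "0 < \<delta>"
    "\<And>M'. M' \<in> NBV N \<Longrightarrow> var_dist N M M' < \<delta> \<Longrightarrow> l < spectral_abscissa M'"
proof -
  have MN: "M \<in> NBV N" and fin: "spectral_abscissa M < \<infinity>" using M by (auto simp: stable_class_def)
  note hol = holomorphic_char_fun[OF N]
  obtain z where z: "char_fun M z = 0" "l < ereal (Re z)"
    using l unfolding spectral_abscissa_def less_Sup_iff by blast
  obtain q where q: "l < ereal q" "q < Re z" using ereal_dense2[OF z(2)] by auto
  \<comment> \<open>A real point to the right of all zeros is not a zero, so the zero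
    \<open>z\<close> is isolated.\<close>
  obtain x where "spectral_abscissa M < ereal x" using ereal_dense2[OF fin] by blast
  then have x: "char_fun M (of_real x) \<noteq> 0" using zero_le_spectral_abscissa[of M "of_real x"] by auto
  obtain r where r: "0 < r" "\<And>w. w \<in> ball z r - {z} \<Longrightarrow> char_fun M w \<noteq> 0"
    by (rule isolated_zeros[OF hol[OF MN] open_UNIV connected_UNIV UNIV_I z(1) UNIV_I x]) (rule that)
  \<comment> \<open>\<open>\<rho> < r\<close> keeps the circle free of zeros, and
    \<open>\<rho> \<le> Re z - q\<close> keeps the disk in the half plane
    \<open>Re s \<ge> q\<close>.\<close>
  define \<rho> where "\<rho> = min (r / 2) (Re z - q)"
  have \<rho>: "0 < \<rho>" "\<rho> < r" "q \<le> Re z - \<rho>" using r(1) q(2) by (auto simp: \<rho>_def)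
  have "continuous_on (sphere z \<rho>) (\<lambda>w. cmod (char_fun M w))"
    using holomorphic_on_imp_continuous_on[OF hol[OF MN]]
    by (intro continuous_on_norm) (rule continuous_on_subset, auto)
  moreover have "sphere z \<rho> \<noteq> {}" using \<rho>(1) by simp
  ultimately obtain w where w: "w \<in> sphere z \<rho>"
    "\<And>v. v \<in> sphere z \<rho> \<Longrightarrow> cmod (char_fun M w) \<le> cmod (char_fun M v)"
    using continuous_attains_inf[OF compact_sphere] by blast
  define m where "m = cmod (char_fun M w)"
  have "w \<in> ball z r - {z}" using w(1) \<rho> by auto
  then have m: "0 < m / 2" using r(2) by (simp add: m_def)
  obtain \<delta> where \<delta>: "0 < \<delta>"
    "\<And>M' s. M' \<in> NBV N \<Longrightarrow> var_dist N M M' < \<delta> \<Longrightarrow> Re z - \<rho> \<le> Re s \<Longrightarrow>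
      cmod (char_fun M s - char_fun M' s) < m / 2"
    using char_fun_uniformly_close[OF N MN m] by blast
  have Re_ge: "Re z - \<rho> \<le> Re s" if "dist z s \<le> \<rho>" for s
    using that abs_Re_le_cmod[of "z - s"] by (simp add: dist_norm)
  show ?thesis
  proof (rule that[OF \<delta>(1)])
    fix M' assume M': "M' \<in> NBV N" "var_dist N M M' < \<delta>"
    \<comment> \<open>On the circle the perturbed function exceeds \<open>m / 2\<close> in modulus,
      while at the center it stays below \<open>m / 2\<close>; this forces a zero inside.\<close>
    have "cmod (char_fun M' z) < cmod (char_fun M' v)" if "cmod (z - v) = \<rho>" for v
    proof -
      have "dist z v = \<rho>" using that by (simp add: dist_norm)
      then have "m \<le> cmod (char_fun M v)" "cmod (char_fun M v - char_fun M' v) < m / 2"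
        using w(2)[of v] \<delta>(2)[OF M' Re_ge[of v]] by (auto simp: m_def)
      moreover have "cmod (char_fun M' z) < m / 2"
        using \<delta>(2)[OF M' Re_ge[of z]] z(1) \<rho>(1) by simp
      moreover have "cmod (char_fun M v) \<le> cmod (char_fun M v - char_fun M' v) + cmod (char_fun M' v)"
        using norm_triangle_sub[of "char_fun M v" "char_fun M' v"] by simp
      ultimately show ?thesis by linarith
    qed
    moreover have "char_fun M' holomorphic_on ball z \<rho>"
      by (rule holomorphic_on_subset[OF hol[OF M'(1)]]) simp
    moreover have "continuous_on (cball z \<rho>) (char_fun M')"
      by (rule continuous_on_subset[OF holomorphic_on_imp_continuous_on[OF hol[OF M'(1)]]]) simp
    ultimately obtain v where v: "v \<in> ball z \<rho>" "char_fun M' v = 0"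
      using holomorphic_contract_to_zero \<rho>(1) by blast
    have "ereal q \<le> ereal (Re v)" using Re_ge[of v] v(1) \<rho>(3) by simp
    also have "\<dots> \<le> spectral_abscissa M'" by (rule zero_le_spectral_abscissa[OF v(2)])
    finally show "l < spectral_abscissa M'" using q(1) by simp
  qed
qed

theorem theorem3p2:
  fixes N :: "real ^ 'n \<Rightarrow> real"
  assumes "is_norm N"
  shows "continuous_map (Metric_space.mtopology (stable_class N) (var_dist N))
           (top_of_set {x::ereal. x < \<infinity>}) spectral_abscissa"
proof -
  interpret Metric_space "stable_class N" "var_dist N"
    by (rule Metric_space_stable_class[OF assms])
  have NBV: "M \<in> NBV N" if "M \<in> stable_class N" for M
    using that by (simp add: stable_class_def)
  \<comment> \<open>In the order topology convergence splits into lower and upper bounds, one for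
    each semicontinuity lemma. Symmetry of the distance is used because neighborhoods measure from
    \<open>M'\<close> to \<open>M\<close>.\<close>
  have "(spectral_abscissa \<longlongrightarrow> spectral_abscissa M) (atin mtopology M)"
    if M: "M \<in> stable_class N" for M
  proof (rule order_tendstoI)
    fix l assume "l < spectral_abscissa M"
    from spectral_abscissa_lower[OF assms M this] obtain \<delta> where "0 < \<delta>"
      "\<And>M'. M' \<in> NBV N \<Longrightarrow> var_dist N M M' < \<delta> \<Longrightarrow> l < spectral_abscissa M'" by blast
    then show "\<forall>\<^sub>F M' in atin mtopology M. l < spectral_abscissa M'"
      unfolding eventually_atin_metric commute[of _ M] using NBV by blast
  next
    fix u assume "spectral_abscissa M < u"
    from spectral_abscissa_upper[OF assms M this] obtain \<delta> where "0 < \<delta>"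
      "\<And>M'. M' \<in> NBV N \<Longrightarrow> var_dist N M M' < \<delta> \<Longrightarrow> spectral_abscissa M' < u" by blast
    then show "\<forall>\<^sub>F M' in atin mtopology M. spectral_abscissa M' < u"
      unfolding eventually_atin_metric commute[of _ M] using NBV by blast
  qed
  then have "continuous_map mtopology euclidean spectral_abscissa"
    by (simp add: continuous_map_atin)
  moreover have "spectral_abscissa \<in> stable_class N \<rightarrow> {x. x < \<infinity>}"
    by (auto simp: stable_class_def)
  ultimately show ?thesis by (simp add: continuous_map_in_subtopology)
qed

end
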